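(* Let $\boldsymbol{S}$ be a regular $m$-tier strip of length $n$ having at least one Kekulé structure, with associated poset $\mathcal{S}$. Let $\mathcal{A}\subset\mathcal{S}$ be an induced subposet of $\mathcal{S}$, and let $\mu:\mathcal{A}\to\{1,\dots,n\}$ be a strictly order-preserving map. Then there exists exactly one Kekulé structure $K$ of $\boldsymbol{S}$ such that 1. $\mathrm{pos}_K(s_{k,j})=\mu(s_{k,j})+j$ for every $s_{k,j}\in\mathcal{A}$, 2. $\mathrm{pos}_K(s_{k,j})=\max\left(\{\mu(s_{k',j'})\mid s_{k',j'}\in\mathcal{A},\ s_{k',j'}<_{\mathcal{S}}s_{k,j}\}\cup\{0\}\right)+j$ for every $s_{k,j}\in\mathcal{S}\setminus\mathcal{A}$, 3. $\mathcal{A}_K=\mathcal{A}$.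
   Context: Geometry. Let $L$ be the infinite hexagonal lattice, drawn so that some of its edges are vertical. A benzenoid is a finite subgraph of $L$ consisting of all vertices and edges lying on or inside a cycle of $L$. A regular 1-tier strip of length $n$ consists of $n$ adjacent hexagons in the same horizontal row of $L$. A regular $m$-tier strip $\boldsymbol{S}$ of length $n$ is obtained by merging $m$ consecutive regular 1-tier strips located in adjacent rows of $L$ (numbered $1,\dots,m$ from top to bottom) such that (i) adjacent strips differ at each end (left and right) by $\pm\frac12$ hexagon unit, and (ii) the top and bottom 1-tier strips both have length $n$. Interfaces and fragments. For $k=1,\dots,m$ the interface $i_k$ is the set of vertical edges of the hexagons in row $k$; its edges are numbered from left to right as $e_{k,1},e_{k,2},\dots$; put $i_0=i_{m+1}=\varnothing$. The fragment $f_k$ ($1\le k\le m+1$) is the set of edges (and vertices) lying at least partially between the horizontal lines $P_{k-1}$ and $P_k$, where $P_k$ ($1\le k\le m$) is the horizontal line through the midpoints of the edges of $i_k$, $P_0$ lies above $\boldsymbol{S}$ and $P_{m+1}$ below $\boldsymbol{S}$. The interface bonds of $f_k$ are the elements of $i_{k-1}\cup i_k$, ordered from left to right by horizontal position; the first one is the leftmost. Kekulé structures. A Kekulé structure $K$ of $\boldsymbol{S}$ is a perfect matching; $K_I=E(K)\cap\bigcup_{k=1}^m i_k$ is its set of double interface bonds. Put $\mathrm{ord}(i_k)=|i_k|-n$. It is known that $|K_I\cap i_k|=\mathrm{ord}(i_k)$ for every Kekulé structure $K$; let $d_{k,j}^K$ be the $j$-th element of $K_I\cap i_k$ from the left. A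 proper sextet of $K$ is a hexagon of $\boldsymbol{S}$ whose right vertical edge, upper-left slanted edge and lower-left slanted edge all belong to $K$; these three edges participate in the proper sextet. Poset $\mathcal{S}$. $\mathcal{S}=\{s_{k,j}: 1\le k\le m,\ 1\le j\le \mathrm{ord}(i_k)\}$ with strict order $<_{\mathcal{S}}$ generated (by transitive closure) by the cover relations: $s_{k,j}\lessdot_{\mathcal{S}}s_{k',j'}$ if and only if $|k'-k|=1$ and, with $\kappa=\max(k,k')$, $j'-j=0$ when the first interface bond of $f_\kappa$ belongs to $i_k$, and $j'-j=1$ when the first interface bond of $f_\kappa$ belongs to $i_{k'}$. Maps attached to $K$. $\tau_K:\mathcal{S}\to K_I$ is $\tau_K(s_{k,j})=d_{k,j}^K$; $\mathrm{pos}_K(s_{k,j})$ is the number such that $\tau_K(s_{k,j})=e_{k,\mathrm{pos}_K(s_{k,j})}$. $\mathcal{A}_K$ is the induced subposet of $\mathcal{S}$ consisting of the $s_{k,j}$ for which $\tau_K(s_{k,j})$ participates in a proper sextet of $K$. An induced subposet is a (possibly empty) subset with the inherited order. A map $\mu$ from a poset to the integers is strictly order-preserving if $s<t\Rightarrow\mu(s)<\mu(t)$. *)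

theory Defs
  imports Main
begin

(* Coordinates for the hexagonal lattice L drawn with vertical edges.  The r-th horizontal zigzag
   (r increasing downwards) has the vertices (r, x), where x is the horizontal position in units of
   half a hexagon width.  With edge length 1, (r, x) is the point of the plane with abscissa
   x * sqrt 3 / 2 and ordinate - 3 * r / 2 - 1 / 4 for even r + x, - 3 * r / 2 + 1 / 4 for odd r + x. *)
type_synonym vertex = "int \<times> int"
type_synonym edge = "vertex set"

definition lattice_edges :: "edge set" where
  "lattice_edges = {{(r, x), (r, x + 1)} | r x. True} \<union> {{(r, x), (r + 1, x)} | r x. even (r + x)}"

(* The hexagon of row r centred at horizontal position c lies between the zigzags r and r + 1
   and is represented by (r, c). *)
type_synonym hexagon = "int \<times> int"

definition lattice_hexagons :: "hexagon set" where
  "lattice_hexagons = {(r, c). odd (r + c)}"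

fun left_edge :: "hexagon \<Rightarrow> edge" where
  "left_edge (r, c) = {(r, c - 1), (r + 1, c - 1)}"

fun right_edge :: "hexagon \<Rightarrow> edge" where
  "right_edge (r, c) = {(r, c + 1), (r + 1, c + 1)}"

fun upper_left_edge :: "hexagon \<Rightarrow> edge" where
  "upper_left_edge (r, c) = {(r, c - 1), (r, c)}"

fun upper_right_edge :: "hexagon \<Rightarrow> edge" where
  "upper_right_edge (r, c) = {(r, c), (r, c + 1)}"

fun lower_left_edge :: "hexagon \<Rightarrow> edge" where
  "lower_left_edge (r, c) = {(r + 1, c - 1), (r + 1, c)}"

fun lower_right_edge :: "hexagon \<Rightarrow> edge" where
  "lower_right_edge (r, c) = {(r + 1, c), (r + 1, c + 1)}"

definition hexagon_edges :: "hexagon \<Rightarrow> edge set" where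
  "hexagon_edges h = {left_edge h, right_edge h, upper_left_edge h, upper_right_edge h,
     lower_left_edge h, lower_right_edge h}"

lemma hexagon_edges_subset_lattice:
  assumes "h \<in> lattice_hexagons"
  shows "hexagon_edges h \<subseteq> lattice_edges"
proof -
  obtain r c where h: "h = (r, c)" by (cases h)
  have p: "even (r + (c - 1))" "even (r + (c + 1))"
    using assms by (auto simp: h lattice_hexagons_def)
  have v: "{(a, x), (a + 1, x)} \<in> lattice_edges" if "even (a + x)" for a x
    using that unfolding lattice_edges_def by blast
  have s: "{(a, x), (a, x + 1)} \<in> lattice_edges" for a x
    unfolding lattice_edges_def by blast
  show ?thesis
    using v[OF p(1)] v[OF p(2)] s[of r "c - 1"] s[of r c] s[of "r + 1" "c - 1"] s[of "r + 1" c]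
    by (simp add: h hexagon_edges_def)
qed

(* A strip is given by its set of hexagons; as a graph it is the union of these hexagons. *)
definition strip_edges :: "hexagon set \<Rightarrow> edge set" where
  "strip_edges S = (\<Union>h\<in>S. hexagon_edges h)"

definition strip_vertices :: "hexagon set \<Rightarrow> vertex set" where
  "strip_vertices S = \<Union> (strip_edges S)"

definition one_tier :: "int \<Rightarrow> int \<Rightarrow> nat \<Rightarrow> hexagon set" where
  "one_tier r c l = {(r, c + 2 * int i) | i. i < l}"

definition right_end :: "int \<Rightarrow> nat \<Rightarrow> int" where
  "right_end c l = c + 2 * int l - 2"

(* One half of a hexagon unit is 1 in the horizontal coordinate.  The origin of the lattice is
   placed so that the top row of the strip is row 1. *)
definition regular_strip :: "nat \<Rightarrow> nat \<Rightarrow> hexagon set \<Rightarrow> bool" where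
  "regular_strip m n S \<longleftrightarrow> m \<ge> 1 \<and>
     (\<exists>c :: nat \<Rightarrow> int. \<exists>len :: nat \<Rightarrow> nat.
        (\<forall>k\<in>{1..m}. len k \<ge> 1 \<and> (int k, c k) \<in> lattice_hexagons) \<and>
        S = (\<Union>k\<in>{1..m}. one_tier (int k) (c k) (len k)) \<and>
        (\<forall>k\<in>{1..<m}. \<bar>c (k + 1) - c k\<bar> = 1 \<and>
           \<bar>right_end (c (k + 1)) (len (k + 1)) - right_end (c k) (len k)\<bar> = 1) \<and>
        len 1 = n \<and> len m = n)"

definition perfect_matching :: "vertex set \<Rightarrow> edge set \<Rightarrow> edge set \<Rightarrow> bool" where
  "perfect_matching V E K \<longleftrightarrow> K \<subseteq> E \<and> (\<forall>v\<in>V. \<exists>!e. e \<in> K \<and> v \<in> e)"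

definition kekule :: "hexagon set \<Rightarrow> edge set \<Rightarrow> bool" where
  "kekule S K \<longleftrightarrow> perfect_matching (strip_vertices S) (strip_edges S) K"

(* Empty unless k is the number of a row of S; in particular i_0 and i_{m+1} are empty. *)
definition interface :: "hexagon set \<Rightarrow> nat \<Rightarrow> edge set" where
  "interface S k = (\<Union>h\<in>{h \<in> S. fst h = int k}. {left_edge h, right_edge h})"

(* Meaningful for vertical edges only: both endpoints have the same second coordinate. *)
definition hpos :: "edge \<Rightarrow> int" where
  "hpos e = the_elem (snd ` e)"

(* The p-th element from the left, counting from 1, of a set X of vertical edges with pairwise
   different horizontal positions; unspecified unless 1 <= p <= card X. *)
definition nth_left :: "edge set \<Rightarrow> nat \<Rightarrow> edge" where
  "nth_left X p = (THE e. e \<in> X \<and> card {e' \<in> X. hpos e' \<le> hpos e} = p)"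

(* The interface bonds of the fragment f_k. *)
definition interface_bonds :: "hexagon set \<Rightarrow> nat \<Rightarrow> edge set" where
  "interface_bonds S k = interface S (k - 1) \<union> interface S k"

definition first_bond :: "hexagon set \<Rightarrow> nat \<Rightarrow> edge" where
  "first_bond S k = nth_left (interface_bonds S k) 1"

definition interface_ord :: "nat \<Rightarrow> hexagon set \<Rightarrow> nat \<Rightarrow> int" where
  "interface_ord n S k = int (card (interface S k)) - int n"

(* The element s_{k,j} is represented by (k, j). *)
definition poset_carrier :: "nat \<Rightarrow> nat \<Rightarrow> hexagon set \<Rightarrow> (nat \<times> nat) set" where
  "poset_carrier m n S = {(k, j). 1 \<le> k \<and> k \<le> m \<and> 1 \<le> j \<and> int j \<le> interface_ord n S k}"

definition poset_cover :: "nat \<Rightarrow> nat \<Rightarrow> hexagon set \<Rightarrow> nat \<times> nat \<Rightarrow> nat \<times> nat \<Rightarrow> bool" where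
  "poset_cover m n S = (\<lambda>(k, j) (k', j').
     (k, j) \<in> poset_carrier m n S \<and> (k', j') \<in> poset_carrier m n S \<and>
     \<bar>int k' - int k\<bar> = 1 \<and>
     (first_bond S (max k k') \<in> interface S k \<and> int j' - int j = 0 \<or>
      first_bond S (max k k') \<in> interface S k' \<and> int j' - int j = 1))"

definition poset_less :: "nat \<Rightarrow> nat \<Rightarrow> hexagon set \<Rightarrow> nat \<times> nat \<Rightarrow> nat \<times> nat \<Rightarrow> bool" where
  "poset_less m n S = (poset_cover m n S)\<^sup>+\<^sup>+"

definition double_interface_bonds :: "nat \<Rightarrow> hexagon set \<Rightarrow> edge set \<Rightarrow> edge set" where
  "double_interface_bonds m S K = K \<inter> (\<Union>k\<in>{1..m}. interface S k)"

fun tau :: "nat \<Rightarrow> hexagon set \<Rightarrow> edge set \<Rightarrow> nat \<times> nat \<Rightarrow> edge" where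
  "tau m S K (k, j) = nth_left (double_interface_bonds m S K \<inter> interface S k) j"

fun pos :: "nat \<Rightarrow> hexagon set \<Rightarrow> edge set \<Rightarrow> nat \<times> nat \<Rightarrow> nat" where
  "pos m S K (k, j) =
     (THE p. p \<in> {1..card (interface S k)} \<and> tau m S K (k, j) = nth_left (interface S k) p)"

definition proper_sextet :: "hexagon set \<Rightarrow> edge set \<Rightarrow> hexagon \<Rightarrow> bool" where
  "proper_sextet S K h \<longleftrightarrow> h \<in> S \<and> {right_edge h, upper_left_edge h, lower_left_edge h} \<subseteq> K"

definition in_proper_sextet :: "hexagon set \<Rightarrow> edge set \<Rightarrow> edge \<Rightarrow> bool" where
  "in_proper_sextet S K e \<longleftrightarrow>
     (\<exists>h. proper_sextet S K h \<and> e \<in> {right_edge h, upper_left_edge h, lower_left_edge h})"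

definition sextet_subposet :: "nat \<Rightarrow> nat \<Rightarrow> hexagon set \<Rightarrow> edge set \<Rightarrow> (nat \<times> nat) set" where
  "sextet_subposet m n S K = {s \<in> poset_carrier m n S. in_proper_sextet S K (tau m S K s)}"

end

theory Submission
  imports Defs
begin

text \<open>
  A Kekule structure is determined by its double interface bonds: once these are fixed, each
  horizontal zigzag is a path with some vertices removed, and such a graph has at most one perfect
  matching.  It has one iff the removed vertices alternate suitably between the row above and the row
  below.  The lemma \<open>path_matching_iff\<close> expresses this by counting: the number of double bonds of
  the lower row up to a position exceeds that of the upper row by one of two fixed consecutive values.

  Comparing the counts at the right ends of the zigzags shows that row \<open>k\<close> contains exactly \<open>ord(i_k)\<close>
  double bonds (\<open>card_rungs\<close>).  Hence the function \<open>pos_K\<close> lists all double interface bonds and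
  determines the Kekule structure (\<open>rungs_eq_pos\<close>, \<open>kekule_eqI\<close>); this gives uniqueness, because the
  first two conditions of the theorem prescribe \<open>pos_K\<close> completely.

  For existence write \<open>pos_K(s) = q(s) + j\<close>.  In these terms, the bond of \<open>s\<close> lies to the left of the
  bond of a cover \<open>t\<close> of \<open>s\<close> iff \<open>q(s) \<le> q(t)\<close>, and the bonds occupy adjacent positions iff equality
  holds.  So, if no \<open>ord(i_k)\<close> is negative, every weakly order-preserving \<open>q\<close> with values in \<open>{0..n}\<close> arises from a Kekule structure
  (\<open>kekule_matching\<close>), and \<open>s\<close> belongs to a proper sextet iff \<open>q(s) > 0\<close> and \<open>q(s) > q(t)\<close> for all
  lower covers \<open>t\<close> of \<open>s\<close> (\<open>sextet_subposet_matching\<close>).  The labelling that equals \<open>\<mu>\<close> on \<open>A\<close> and is the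
  maximum of the preceding values of \<open>\<mu>\<close>, or 0, elsewhere is order-preserving, and it increases strictly
  over 0 and over all lower covers precisely at the elements of \<open>A\<close>.
\<close>

section \<open>Counting along a path and matchings of a path\<close>

definition count_upto :: "int set \<Rightarrow> int \<Rightarrow> int" where
  "count_upto U x = int (card {y \<in> U. y \<le> x})"

lemma count_upto_step:
  assumes "finite U"
  shows "count_upto U x = count_upto U (x - 1) + of_bool (x \<in> U)"
proof -
  have "{y \<in> U. y \<le> x} = {y \<in> U. y \<le> x - 1} \<union> (if x \<in> U then {x} else {})"
    by (auto simp: order_le_less)
  moreover have "card ({y \<in> U. y \<le> x - 1} \<union> {x}) = Suc (card {y \<in> U. y \<le> x - 1})"
    using assms by (subst card_Un_disjoint) auto
  ultimately show ?thesis by (simp add: count_upto_def)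
qed

lemma count_upto_below: "\<forall>y\<in>U. x < y \<Longrightarrow> count_upto U x = 0"
  by (auto simp: count_upto_def card_eq_0_iff)

lemma count_upto_above: "\<forall>y\<in>U. y \<le> x \<Longrightarrow> count_upto U x = int (card U)"
  by (simp add: count_upto_def Collect_conj_eq Int_absorb2 subset_iff cong: conj_cong)

lemma count_upto_strict:
  assumes "finite U" "x < y" "y \<in> U"
  shows "count_upto U x < count_upto U y"
proof -
  have "{z \<in> U. z \<le> x} \<subset> {z \<in> U. z \<le> y}" using assms by force
  then show ?thesis using assms(1) by (simp add: count_upto_def psubset_card_mono)
qed

lemma count_upto_image:
  fixes X :: "nat \<Rightarrow> int"
  assumes "inj_on X J"
  shows "count_upto (X ` J) x = int (card {j \<in> J. X j \<le> x})"
proof -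
  have "{y \<in> X ` J. y \<le> x} = X ` {j \<in> J. X j \<le> x}" by auto
  moreover have "inj_on X {j \<in> J. X j \<le> x}" using assms by (rule inj_on_subset) auto
  ultimately show ?thesis by (simp add: count_upto_def card_image)
qed

lemma count_upto_image_at:
  fixes X :: "nat \<Rightarrow> int"
  assumes "strict_mono_on {1..N} X" "j \<in> {1..N}"
  shows "count_upto (X ` {1..N}) (X j) = int j"
proof -
  have "{i \<in> {1..N}. X i \<le> X j} = {1..j}"
    using assms strict_mono_on_less_eq[OF assms(1)] by auto
  then show ?thesis
    using count_upto_image[OF strict_mono_on_imp_inj_on[OF assms(1)], of "X j"] by simp
qed

lemma ex_count_upto:
  assumes "finite U" "1 \<le> j" "j \<le> int (card U)"
  shows "\<exists>x\<in>U. count_upto U x = j"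
proof -
  have "inj_on (count_upto U) U"
    by (rule linorder_inj_onI) (use count_upto_strict[OF assms(1)] in \<open>force+\<close>)
  then have "card (count_upto U ` U) = card {1..int (card U)}" by (simp add: card_image)
  moreover have "count_upto U x \<in> {1..int (card U)}" if "x \<in> U" for x
  proof -
    have "card {y \<in> U. y \<le> x} \<le> card U" "0 < card {y \<in> U. y \<le> x}"
      using assms(1) that by (auto intro!: card_mono simp: card_gt_0_iff)
    then show ?thesis by (simp add: count_upto_def)
  qed
  then have "count_upto U ` U \<subseteq> {1..int (card U)}" by auto
  ultimately have "count_upto U ` U = {1..int (card U)}" by (intro card_subset_eq) auto
  then have "j \<in> count_upto U ` U" using assms by auto
  then show ?thesis by auto
qed

text \<open>
  Along a path whose vertices are alternately of an upper and a lower kind, suppose that the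
  vertices in \<open>U\<close> (upper) and \<open>W\<close> (lower) are already covered, and let \<open>x \<in> H\<close> mean that the path edge
  from \<open>x\<close> to \<open>x + 1\<close> is chosen.  Passing an upper vertex lowers the difference of the two counts by
  one exactly if neither neighbouring path edge is chosen, passing a lower vertex raises it.  So the
  condition at \<open>x\<close> is the difference of the equations on the right at \<open>x\<close> and \<open>x - 1\<close>, and
  telescoping from the left end gives the equivalence.  Two consequences matter: the covered vertices
  determine the chosen path edges, and the difference of the counts takes only two consecutive
  values, which is the interlacing of \<open>U\<close> and \<open>W\<close>.
\<close>

lemma path_matching_iff:
  fixes lo hi r :: int and U W H :: "int set"
  assumes "lo \<le> hi"
    and U: "U \<subseteq> {lo..hi}" "\<forall>x\<in>U. even (x + r)"
    and W: "W \<subseteq> {lo..hi}" "\<forall>x\<in>W. odd (x + r)"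
  shows "lo - 1 \<notin> H \<and>
      (\<forall>x\<in>{lo..hi}. of_bool (x \<in> U) + of_bool (x \<in> W) + of_bool (x - 1 \<in> H) + of_bool (x \<in> H)
         = (1::int)) \<longleftrightarrow>
    (\<forall>x\<in>{lo - 1..hi}. count_upto W x - count_upto U x =
       (if odd (x + r) then 1 - of_bool (x \<in> H) else of_bool (x \<in> H)) - of_bool (even (lo + r)))"
    (is "?L \<longleftrightarrow> (\<forall>x\<in>_. ?D x = ?e x)")
proof -
  have fin: "finite U" "finite W" using U(1) W(1) finite_subset by blast+
  have base: "?D (lo - 1) = ?e (lo - 1) \<longleftrightarrow> lo - 1 \<notin> H"
  proof -
    have "count_upto U (lo - 1) = 0" "count_upto W (lo - 1) = 0"
      using U(1) W(1) by (auto intro!: count_upto_below)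
    then show ?thesis by auto
  qed
  have path_step: "?D x = ?e x \<longleftrightarrow>
      of_bool (x \<in> U) + of_bool (x \<in> W) + of_bool (x - 1 \<in> H) + of_bool (x \<in> H) = (1::int)"
    if "?D (x - 1) = ?e (x - 1)" for x
  proof (cases "even (x + r)")
    case True
    then have "x \<notin> W" using W(2) by auto
    then show ?thesis
      using that True count_upto_step[OF fin(1), of x] count_upto_step[OF fin(2), of x]
      by (cases "x \<in> U"; cases "x - 1 \<in> H"; cases "x \<in> H") simp_all
  next
    case False
    then have "x \<notin> U" using U(2) by auto
    then show ?thesis
      using that False count_upto_step[OF fin(1), of x] count_upto_step[OF fin(2), of x]
      by (cases "x \<in> W"; cases "x - 1 \<in> H"; cases "x \<in> H") simp_all
  qed
  show ?thesis
  proof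
    assume L: ?L
    have "x \<le> hi \<longrightarrow> ?D x = ?e x" if "lo - 1 \<le> x" for x
      using that
    proof (induction x rule: int_ge_induct)
      case base
      then show ?case using L \<open>?D (lo - 1) = ?e (lo - 1) \<longleftrightarrow> _\<close> by blast
    next
      case (step i)
      show ?case
      proof
        assume "i + 1 \<le> hi"
        have "lo \<le> i + 1" using step.hyps by simp
        moreover have "?D (i + 1 - 1) = ?e (i + 1 - 1)" using step.IH \<open>i + 1 \<le> hi\<close> by simp
        ultimately show "?D (i + 1) = ?e (i + 1)"
          using path_step[of "i + 1"] conjunct2[OF L, THEN bspec, of "i + 1"] \<open>i + 1 \<le> hi\<close>
          by (simp only: atLeastAtMost_iff)
      qed
    qed
    then show "\<forall>x\<in>{lo - 1..hi}. ?D x = ?e x" by auto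
  next
    assume R: "\<forall>x\<in>{lo - 1..hi}. ?D x = ?e x"
    show ?L
    proof (intro conjI ballI)
      show "lo - 1 \<notin> H" using R base \<open>lo \<le> hi\<close> by auto
    next
      fix x assume x: "x \<in> {lo..hi}"
      then show "of_bool (x \<in> U) + of_bool (x \<in> W) + of_bool (x - 1 \<in> H) + of_bool (x \<in> H)
         = (1::int)"
        using path_step[of x] R by auto
    qed
  qed
qed

section \<open>Vertical and slanted edges\<close>

text \<open>
  From here on the edges of a hexagon are rewritten to \<open>vert\<close> and \<open>slant\<close> only.
\<close>

declare left_edge.simps [simp del] right_edge.simps [simp del]
  upper_left_edge.simps [simp del] upper_right_edge.simps [simp del]
  lower_left_edge.simps [simp del] lower_right_edge.simps [simp del]

definition vert :: "nat \<Rightarrow> int \<Rightarrow> edge" where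
  "vert k x = {(int k, x), (int k + 1, x)}"

text \<open>
  The zigzag indexed by \<open>k\<close> is the lattice zigzag \<open>k + 1\<close>, which separates row \<open>k\<close> from row
  \<open>k + 1\<close>; with this shift the zigzags of a strip with \<open>m\<close> rows are \<open>0, ..., m\<close>.
\<close>

definition slant :: "nat \<Rightarrow> int \<Rightarrow> edge" where
  "slant k x = {(int k + 1, x), (int k + 1, x + 1)}"

lemma vert_eq_iff [simp]: "vert k x = vert k' x' \<longleftrightarrow> k = k' \<and> x = x'"
  by (auto simp: vert_def doubleton_eq_iff)

lemma slant_eq_iff [simp]: "slant k x = slant k' x' \<longleftrightarrow> k = k' \<and> x = x'"
  by (auto simp: slant_def doubleton_eq_iff)

lemma vert_neq_slant [simp]: "vert k x \<noteq> slant k' x'" "slant k' x' \<noteq> vert k x"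
  by (auto simp: vert_def slant_def doubleton_eq_iff)

lemma mem_vert_iff: "(int k + 1, y) \<in> vert k' x \<longleftrightarrow> y = x \<and> (k' = k \<or> k' = Suc k)"
  by (auto simp: vert_def)

lemma mem_slant_iff: "(int k + 1, y) \<in> slant k' x \<longleftrightarrow> k' = k \<and> (y = x \<or> y - 1 = x)"
  by (auto simp: slant_def)

lemma hpos_vert [simp]: "hpos (vert k x) = x"
  by (simp add: hpos_def vert_def)

lemma nth_left_eqI:
  assumes "finite X" "inj_on hpos X" "e \<in> X" "card {e' \<in> X. hpos e' \<le> hpos e} = p"
  shows "nth_left X p = e"
  unfolding nth_left_def
proof (rule the_equality)
  fix e1 assume e1: "e1 \<in> X \<and> card {e' \<in> X. hpos e' \<le> hpos e1} = p"
  have less: "card {e' \<in> X. hpos e' \<le> hpos u} < card {e' \<in> X. hpos e' \<le> hpos v}"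
    if "v \<in> X" "hpos u < hpos v" for u v
    by (rule psubset_card_mono) (use assms(1) that in force)+
  have "hpos e1 = hpos e"
    using less[of e e1] less[of e1 e] e1 assms(3,4) by (metis less_irrefl linorder_neqE)
  then show "e1 = e" using assms(2,3) e1 by (meson inj_onD)
qed (use assms in auto)

lemma nth_left_1:
  assumes "finite X" "inj_on hpos X" "e \<in> X" "\<forall>e'\<in>X. hpos e \<le> hpos e'"
  shows "nth_left X 1 = e"
proof -
  have "{e' \<in> X. hpos e' \<le> hpos e} = {e}"
    using assms by (auto dest: inj_onD intro: antisym)
  then show ?thesis using assms by (intro nth_left_eqI) simp_all
qed

lemma nth_left_vert:
  assumes "finite U" "x \<in> U" "count_upto U x = int p"
  shows "nth_left (vert k ` U) p = vert k x"
proof (rule nth_left_eqI)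
  have "{e' \<in> vert k ` U. hpos e' \<le> hpos (vert k x)} = vert k ` {y \<in> U. y \<le> x}" by auto
  moreover have "inj_on (vert k) A" for A by (auto intro: inj_onI)
  ultimately show "card {e' \<in> vert k ` U. hpos e' \<le> hpos (vert k x)} = p"
    using assms(3) by (simp add: card_image count_upto_def)
qed (use assms in \<open>auto intro: inj_onI\<close>)

section \<open>Rows, zigzags and the graph of the strip\<close>

text \<open>
  Row \<open>k\<close> has \<open>l k\<close> hexagons and its leftmost vertical edge is at position \<open>a k\<close>.  Virtual rows
  \<open>0\<close> and \<open>m + 1\<close> of length \<open>n - 1\<close> are added inside the horizontal range of the first and the last
  row; they carry no vertical edges.  They make the top and bottom zigzags look like all the others,
  and their \<open>ord\<close> is zero, so that inductions over rows can start there.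
\<close>

locale strip_rows =
  fixes m n :: nat and S :: "hexagon set" and a :: "nat \<Rightarrow> int" and l :: "nat \<Rightarrow> nat"
  assumes parity: "k \<le> Suc m \<Longrightarrow> even (a k + int k)"
    and left_step: "k \<le> m \<Longrightarrow> \<bar>a (Suc k) - a k\<bar> = 1"
    and right_step: "k \<le> m \<Longrightarrow> \<bar>(a (Suc k) + 2 * int (l (Suc k))) - (a k + 2 * int (l k))\<bar> = 1"
    and length_pos: "1 \<le> k \<Longrightarrow> k \<le> m \<Longrightarrow> 1 \<le> l k"
    and outer_left: "a 0 = a 1 + 1" "a (Suc m) = a m + 1"
    and outer_length: "Suc (l 0) = n" "l 1 = n" "l m = n" "Suc (l (Suc m)) = n"
    and hexagons: "S = {(int k, x + 1) | k x. 1 \<le> k \<and> k \<le> m \<and>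
      a k \<le> x \<and> x < a k + 2 * int (l k) \<and> even (x + int k)}"
begin

definition b :: "nat \<Rightarrow> int" where "b k = a k + 2 * int (l k)"

definition bonds :: "nat \<Rightarrow> int set" where
  "bonds k = {x. a k \<le> x \<and> x \<le> b k \<and> even (x + int k)}"

definition lo :: "nat \<Rightarrow> int" where "lo k = min (a k) (a (Suc k))"
definition hi :: "nat \<Rightarrow> int" where "hi k = max (b k) (b (Suc k))"

lemma finite_bonds [simp]: "finite (bonds k)"
  by (rule finite_subset[of _ "{a k..b k}"]) (auto simp: bonds_def)

lemma m_pos: "1 \<le> m"
  using outer_length outer_left by (cases m) auto

lemma b_step: "k \<le> m \<Longrightarrow> \<bar>b (Suc k) - b k\<bar> = 1"
  using right_step by (simp add: b_def)

lemma b_outer: "b 0 = b 1 - 1" "b (Suc m) = b m - 1"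
  using outer_length outer_left by (auto simp: b_def)

lemma b_parity: "k \<le> Suc m \<Longrightarrow> even (b k + int k)"
  using parity[of k] by (simp add: b_def)

lemma a_less_b: "1 \<le> k \<Longrightarrow> k \<le> m \<Longrightarrow> a k + 2 \<le> b k"
  using length_pos[of k] by (simp add: b_def)

lemma mem_hexagons: "(int k, c) \<in> S \<longleftrightarrow>
    1 \<le> k \<and> k \<le> m \<and> a k < c \<and> c \<le> b k \<and> odd (c + int k)"
proof -
  have "(int k, c) \<in> S \<longleftrightarrow> (\<exists>x. c = x + 1 \<and> 1 \<le> k \<and> k \<le> m \<and> a k \<le> x \<and> x < b k \<and> even (x + int k))"
    unfolding hexagons b_def by auto
  also have "\<dots> \<longleftrightarrow> 1 \<le> k \<and> k \<le> m \<and> a k \<le> c - 1 \<and> c - 1 < b k \<and> even (c - 1 + int k)"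
    by (auto intro: exI[of _ "c - 1"])
  finally have "(int k, c) \<in> S \<longleftrightarrow> 1 \<le> k \<and> k \<le> m \<and> a k \<le> c - 1 \<and> c - 1 < b k \<and> even (c - 1 + int k)" .
  then show ?thesis by auto
qed

lemma hexagonE:
  assumes "h \<in> S"
  obtains k c where "h = (int k, c)" "1 \<le> k" "k \<le> m" "a k < c" "c \<le> b k" "odd (c + int k)"
proof -
  obtain k x where "h = (int k, x)" using assms hexagons by auto
  then show ?thesis using assms mem_hexagons that by blast
qed

lemma lattice_edge_eqs:
  "left_edge (int k, c) = vert k (c - 1)"
  "right_edge (int k, c) = vert k (c + 1)"
  "lower_left_edge (int k, c) = slant k (c - 1)"
  "lower_right_edge (int k, c) = slant k c"
  "1 \<le> k \<Longrightarrow> upper_left_edge (int k, c) = slant (k - 1) (c - 1)"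
  "1 \<le> k \<Longrightarrow> upper_right_edge (int k, c) = slant (k - 1) c"
  by (auto simp: vert_def slant_def left_edge.simps right_edge.simps upper_left_edge.simps
      upper_right_edge.simps lower_left_edge.simps lower_right_edge.simps)

text \<open>
  Adjacent rows of the strip overlap horizontally, because every row has a hexagon and the ends of
  adjacent rows differ by half a unit.  Hence the edges of an inner zigzag \<open>k\<close> form one path from
  \<open>lo k\<close> to \<open>hi k\<close>; the outer zigzags are bounded by a single row, which contains the virtual one.
\<close>

lemma strip_edges_eq:
  "strip_edges S = {vert k x | k x. 1 \<le> k \<and> k \<le> m \<and> x \<in> bonds k} \<union>
     {slant k x | k x. k \<le> m \<and> lo k \<le> x \<and> x < hi k}" (is "_ = ?V \<union> ?H")
proof (intro equalityI subsetI)
  fix e assume "e \<in> strip_edges S"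
  then obtain h where h: "h \<in> S" "e \<in> hexagon_edges h" by (auto simp: strip_edges_def)
  obtain k c where k: "h = (int k, c)" "1 \<le> k" "k \<le> m" "a k < c" "c \<le> b k" "odd (c + int k)"
    using hexagonE[OF h(1)] .
  have c: "c < b k"
    using k(5,6) b_parity[of k] k(3) by (cases "c = b k") auto
  have v: "vert k (c - 1) \<in> ?V" "vert k (c + 1) \<in> ?V"
    using k c by (auto simp: bonds_def)
  have s: "slant k' y \<in> ?H" if "k' = k \<or> Suc k' = k" "y = c - 1 \<or> y = c" for k' y
    using that k c by (auto simp: lo_def hi_def)
  show "e \<in> ?V \<union> ?H"
  proof -
    have "e \<in> {vert k (c - 1), vert k (c + 1), slant (k - 1) (c - 1), slant (k - 1) c,
        slant k (c - 1), slant k c}"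
      using h(2) unfolding k(1) hexagon_edges_def lattice_edge_eqs lattice_edge_eqs(5,6)[OF k(2)]
      by blast
    then show ?thesis
      using v s[of k "c - 1"] s[of k c] s[of "k - 1" "c - 1"] s[of "k - 1" c] k(2) by fastforce
  qed
next
  fix e assume e: "e \<in> ?V \<union> ?H"
  have mem: "e' \<in> strip_edges S"
    if "(int k, c) \<in> S" "e' \<in> hexagon_edges (int k, c)" for k c e'
    using that by (auto simp: strip_edges_def)
  consider (V) k x where "e = vert k x" "1 \<le> k" "k \<le> m" "x \<in> bonds k"
    | (H) k x where "e = slant k x" "k \<le> m" "lo k \<le> x" "x < hi k"
    using e by blast
  then show "e \<in> strip_edges S"
  proof cases
    case V
    show ?thesis
    proof (cases "x = b k")
      case True
      have "(int k, x - 1) \<in> S"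
        using V True b_parity[of k] a_less_b[of k] by (auto simp: mem_hexagons)
      then show ?thesis
        by (rule mem) (simp add: hexagon_edges_def lattice_edge_eqs V(1))
    next
      case False
      have "(int k, x + 1) \<in> S"
        using V False by (auto simp: mem_hexagons bonds_def)
      then show ?thesis
        by (rule mem) (simp add: hexagon_edges_def lattice_edge_eqs V(1))
    qed
  next
    case H
    have edge: "slant i x \<in> strip_edges S"
      if "1 \<le> k" "k \<le> m" "a k \<le> x" "x < b k" "i = k \<or> Suc i = k" for k i
    proof (cases "even (x + int k)")
      case True
      then have "(int k, x + 1) \<in> S" using that by (auto simp: mem_hexagons)
      then show ?thesis
        by (rule mem) (use that lattice_edge_eqs(3,5)[of k "x + 1"] in \<open>auto simp: hexagon_edges_def\<close>)
    next
      case False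
      then have "a k \<noteq> x" using parity[of k] that by auto
      then have "(int k, x) \<in> S" using that False by (auto simp: mem_hexagons)
      then show ?thesis
        by (rule mem) (use that lattice_edge_eqs(4,6)[of k x] in \<open>auto simp: hexagon_edges_def\<close>)
    qed
    consider "k = 0" | "k = m" | "1 \<le> k" "Suc k \<le> m" using H(2) by linarith
    then show ?thesis
    proof cases
      case 1
      then show ?thesis
        using H edge[of 1 k] m_pos outer_left b_outer by (auto simp: lo_def hi_def)
    next
      case 2
      then show ?thesis
        using H edge[of m k] m_pos outer_left b_outer by (auto simp: lo_def hi_def)
    next
      case 3
      then show ?thesis
        using H edge[of k k] edge[of "Suc k" k] left_step[of k] b_step[of k] a_less_b[of k]
          a_less_b[of "Suc k"] by (fastforce simp: lo_def hi_def)
    qed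
  qed
qed

lemma vert_mem_strip [simp]: "vert k x \<in> strip_edges S \<longleftrightarrow> 1 \<le> k \<and> k \<le> m \<and> x \<in> bonds k"
  by (auto simp: strip_edges_eq)

lemma slant_mem_strip [simp]: "slant k x \<in> strip_edges S \<longleftrightarrow> k \<le> m \<and> lo k \<le> x \<and> x < hi k"
  by (auto simp: strip_edges_eq)

lemma lo_less_hi: "k \<le> m \<Longrightarrow> lo k < hi k"
  using left_step[of k] b_step[of k] a_less_b[of k] a_less_b[of "Suc k"] m_pos outer_left b_outer
  by (cases "k = 0"; cases "k = m") (auto simp: lo_def hi_def)

lemma bonds_in_zigzag:
  "k \<le> m \<Longrightarrow> bonds k \<subseteq> {lo k..hi k}" "k \<le> m \<Longrightarrow> bonds (Suc k) \<subseteq> {lo k..hi k}"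
  by (auto simp: bonds_def lo_def hi_def)

lemma strip_vertices_eq:
  "strip_vertices S = {(int k + 1, x) | k x. k \<le> m \<and> lo k \<le> x \<and> x \<le> hi k}"
proof (intro equalityI subsetI)
  fix v assume "v \<in> strip_vertices S"
  then obtain e where e: "e \<in> strip_edges S" "v \<in> e" by (auto simp: strip_vertices_def)
  from e(1) consider (V) k x where "e = vert k x" "1 \<le> k" "k \<le> m" "x \<in> bonds k"
    | (H) k x where "e = slant k x" "k \<le> m" "lo k \<le> x" "x < hi k"
    by (auto simp: strip_edges_eq)
  then show "v \<in> {(int k + 1, x) | k x. k \<le> m \<and> lo k \<le> x \<and> x \<le> hi k}"
  proof cases
    case V
    then obtain k' where k': "k = Suc k'" by (cases k) auto
    have "v = (int k' + 1, x) \<or> v = (int k + 1, x)" using e(2) V(1) k' by (auto simp: vert_def)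
    moreover have "lo k' \<le> x" "x \<le> hi k'" "lo k \<le> x" "x \<le> hi k"
      using V bonds_in_zigzag(1)[of k] bonds_in_zigzag(2)[of k'] k' by auto
    ultimately show ?thesis using V(3) k' Suc_leD by blast
  next
    case H
    then show ?thesis using e(2) by (auto simp: slant_def)
  qed
next
  fix v assume "v \<in> {(int k + 1, x) | k x. k \<le> m \<and> lo k \<le> x \<and> x \<le> hi k}"
  then obtain k x where v: "v = (int k + 1, x)" "k \<le> m" "lo k \<le> x" "x \<le> hi k" by blast
  have "slant k (if x < hi k then x else x - 1) \<in> strip_edges S" using v lo_less_hi[of k] by auto
  moreover have "v \<in> slant k (if x < hi k then x else x - 1)" using v by (auto simp: slant_def)
  ultimately show "v \<in> strip_vertices S" unfolding strip_vertices_def by blast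
qed

lemma ex1_iff_card: "(\<exists>!x. P x) \<longleftrightarrow> card {x. P x} = 1"
  unfolding One_nat_def card_1_singleton_iff by (auto simp: set_eq_iff)

lemma kekule_iff:
  "kekule S K \<longleftrightarrow> K \<subseteq> strip_edges S \<and> (\<forall>k\<le>m. \<forall>x\<in>{lo k..hi k}.
     of_bool (vert k x \<in> K) + of_bool (vert (Suc k) x \<in> K) +
     of_bool (slant k (x - 1) \<in> K) + of_bool (slant k x \<in> K) = (1::int))"
proof (cases "K \<subseteq> strip_edges S")
  case True
  have "(\<exists>!e. e \<in> K \<and> (int k + 1, x) \<in> e) \<longleftrightarrow>
     of_bool (vert k x \<in> K) + of_bool (vert (Suc k) x \<in> K) +
     of_bool (slant k (x - 1) \<in> K) + of_bool (slant k x \<in> K) = (1::int)" for k x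
  proof -
    let ?F = "{vert k x, vert (Suc k) x, slant k (x - 1), slant k x}"
    have "{e. e \<in> K \<and> (int k + 1, x) \<in> e} = K \<inter> ?F"
      using True by (auto simp: strip_edges_eq mem_vert_iff mem_slant_iff)
    moreover have "int (card (K \<inter> ?F)) = of_bool (vert k x \<in> K) + of_bool (vert (Suc k) x \<in> K) +
        of_bool (slant k (x - 1) \<in> K) + of_bool (slant k x \<in> K)"
      by (cases "vert k x \<in> K"; cases "vert (Suc k) x \<in> K"; cases "slant k (x - 1) \<in> K";
          cases "slant k x \<in> K") (simp_all add: Int_insert_right)
    moreover have "card (K \<inter> ?F) = 1 \<longleftrightarrow> int (card (K \<inter> ?F)) = 1" by simp
    ultimately show ?thesis by (simp only: ex1_iff_card)
  qed
  moreover have "(\<forall>v\<in>strip_vertices S. Q v) \<longleftrightarrow> (\<forall>k\<le>m. \<forall>x\<in>{lo k..hi k}. Q (int k + 1, x))" for Q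
    unfolding strip_vertices_eq by fastforce
  ultimately show ?thesis
    using True unfolding kekule_def perfect_matching_def by simp
qed (simp add: kekule_def perfect_matching_def)

section \<open>Kekule structures as families of bond positions\<close>

text \<open>
  The parity of an end of a zigzag tells to which of the two rows the first or last vertical edge
  at this zigzag belongs.
\<close>

lemma lo_parity: "k \<le> m \<Longrightarrow> even (lo k + int k) \<longleftrightarrow> a k < a (Suc k)"
  using parity[of k] parity[of "Suc k"] left_step[of k] by (auto simp: lo_def min_def)

lemma hi_parity: "k \<le> m \<Longrightarrow> odd (hi k + int k) \<longleftrightarrow> b k < b (Suc k)"
  using b_parity[of k] b_parity[of "Suc k"] b_step[of k] by (auto simp: hi_def max_def)

definition rungs :: "edge set \<Rightarrow> nat \<Rightarrow> int set" where
  "rungs K k = {x. vert k x \<in> K}"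

lemma rungs_subset: "K \<subseteq> strip_edges S \<Longrightarrow> rungs K k \<subseteq> bonds k"
  using vert_mem_strip by (auto simp: rungs_def)

lemma rungs_outer: "K \<subseteq> strip_edges S \<Longrightarrow> rungs K 0 = {}" "K \<subseteq> strip_edges S \<Longrightarrow> rungs K (Suc m) = {}"
  using vert_mem_strip by (auto simp: rungs_def)

lemma kekule_subset: "kekule S K \<Longrightarrow> K \<subseteq> strip_edges S"
  by (simp add: kekule_def perfect_matching_def)

text \<open>
  The path criterion on every zigzag turns the matching condition into a statement about the number
  of double bonds in adjacent interfaces up to each position.
\<close>

lemma kekule_iff_surplus:
  assumes "K \<subseteq> strip_edges S"
  shows "kekule S K \<longleftrightarrow> (\<forall>k\<le>m. \<forall>x\<in>{lo k - 1..hi k}.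
    count_upto (rungs K (Suc k)) x - count_upto (rungs K k) x =
    (if odd (x + int k) then 1 - of_bool (slant k x \<in> K) else of_bool (slant k x \<in> K)) -
    of_bool (a k < a (Suc k)))"
proof -
  have "(\<forall>x\<in>{lo k..hi k}. of_bool (vert k x \<in> K) + of_bool (vert (Suc k) x \<in> K) +
     of_bool (slant k (x - 1) \<in> K) + of_bool (slant k x \<in> K) = (1::int)) \<longleftrightarrow>
    (\<forall>x\<in>{lo k - 1..hi k}. count_upto (rungs K (Suc k)) x - count_upto (rungs K k) x =
    (if odd (x + int k) then 1 - of_bool (slant k x \<in> K) else of_bool (slant k x \<in> K)) -
    of_bool (a k < a (Suc k)))" if "k \<le> m" for k
  proof -
    let ?H = "{x. slant k x \<in> K}"
    have r: "rungs K k \<subseteq> {lo k..hi k}" "rungs K (Suc k) \<subseteq> {lo k..hi k}"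
      "\<forall>x\<in>rungs K k. even (x + int k)" "\<forall>x\<in>rungs K (Suc k). odd (x + int k)"
      using rungs_subset[OF assms, of k] rungs_subset[OF assms, of "Suc k"] bonds_in_zigzag[OF that]
      by (auto simp: bonds_def)
    have "lo k - 1 \<notin> ?H" using assms slant_mem_strip[of k "lo k - 1"] by auto
    then show ?thesis
      using path_matching_iff[OF less_imp_le[OF lo_less_hi[OF that]] r(1,3,2,4), of ?H]
      unfolding lo_parity[OF that] rungs_def mem_Collect_eq by blast
  qed
  then show ?thesis using assms by (simp add: kekule_iff)
qed

text \<open>
  This is \<open>ord(i_k)\<close>, extended by zero to the two virtual rows.
\<close>

definition excess :: "nat \<Rightarrow> int" where "excess k = int (l k) + 1 - int n"

lemma excess_outer: "excess 0 = 0" "excess (Suc m) = 0"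
  using outer_length by (auto simp: excess_def)

lemma excess_step:
  "k \<le> m \<Longrightarrow> excess (Suc k) = excess k + of_bool (b k < b (Suc k)) - of_bool (a k < a (Suc k))"
  using left_step[of k] b_step[of k] by (auto simp: excess_def b_def)

text \<open>
  Evaluating the surplus at the right end of zigzag \<open>k\<close> shows that the number of double bonds
  changes from row to row exactly as the row length does; there are none in the virtual row \<open>0\<close>.
\<close>

lemma card_rungs:
  assumes "kekule S K" "k \<le> Suc m"
  shows "int (card (rungs K k)) = excess k"
  using assms(2)
proof (induction k)
  case 0
  then show ?case using rungs_outer(1)[OF kekule_subset[OF assms(1)]] by (simp add: excess_outer)
next
  case (Suc k)
  then have k: "k \<le> m" by simp
  note sub = kekule_subset[OF assms(1)]
  have "slant k (hi k) \<notin> K" using sub slant_mem_strip[of k "hi k"] by auto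
  moreover have "hi k \<in> {lo k - 1..hi k}" using lo_less_hi[OF k] by simp
  ultimately have "count_upto (rungs K (Suc k)) (hi k) - count_upto (rungs K k) (hi k) =
      of_bool (b k < b (Suc k)) - of_bool (a k < a (Suc k))"
    using assms(1) k hi_parity[OF k] unfolding kekule_iff_surplus[OF sub] by (simp del: odd_add even_add)
  moreover have "count_upto (rungs K i) (hi k) = int (card (rungs K i))" if "i = k \<or> i = Suc k" for i
    using that rungs_subset[OF sub, of i] bonds_in_zigzag[OF k] by (intro count_upto_above) auto
  ultimately show ?case using Suc excess_step[OF k] by simp
qed

lemma kekule_eqI:
  assumes "kekule S K" "kekule S K'" and "\<And>k. 1 \<le> k \<Longrightarrow> k \<le> m \<Longrightarrow> rungs K k = rungs K' k"
  shows "K = K'"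
proof -
  note sub = kekule_subset[OF assms(1)] kekule_subset[OF assms(2)]
  have rungs: "rungs K k = rungs K' k" if "k \<le> Suc m" for k
    using that assms(3)[of k] rungs_outer[OF sub(1)] rungs_outer[OF sub(2)]
    by (cases "k = 0"; cases "k = Suc m") auto
  have slants: "slant k x \<in> K \<longleftrightarrow> slant k x \<in> K'" if "k \<le> m" "lo k \<le> x" "x < hi k" for k x
  proof -
    have *: "count_upto (rungs K (Suc k)) x - count_upto (rungs K k) x =
      (if odd (x + int k) then 1 - of_bool (slant k x \<in> K) else of_bool (slant k x \<in> K)) -
      of_bool (a k < a (Suc k))"
      "count_upto (rungs K' (Suc k)) x - count_upto (rungs K' k) x =
      (if odd (x + int k) then 1 - of_bool (slant k x \<in> K') else of_bool (slant k x \<in> K')) -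
      of_bool (a k < a (Suc k))"
      using assms(1,2) that unfolding kekule_iff_surplus[OF sub(1)] kekule_iff_surplus[OF sub(2)]
      by auto
    have "(if odd (x + int k) then 1 - of_bool (slant k x \<in> K) else of_bool (slant k x \<in> K)) =
      (if odd (x + int k) then 1 - of_bool (slant k x \<in> K') else of_bool (slant k x \<in> K') :: int)"
      using * rungs[of k] rungs[of "Suc k"] that(1) by simp
    then show ?thesis by (cases "odd (x + int k)") (simp_all add: of_bool_eq_iff)
  qed
  have "e \<in> K \<longleftrightarrow> e \<in> K'" if e: "e \<in> strip_edges S" for e
  proof -
    from e consider (V) k x where "e = vert k x" "1 \<le> k" "k \<le> m"
      | (H) k x where "e = slant k x" "k \<le> m" "lo k \<le> x" "x < hi k"
      unfolding strip_edges_eq by blast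
    then show ?thesis
    proof cases
      case V
      have "x \<in> rungs K k \<longleftrightarrow> x \<in> rungs K' k" using assms(3)[OF V(2,3)] by simp
      then show ?thesis by (simp add: V(1) rungs_def)
    qed (simp add: slants)
  qed
  then show ?thesis using sub by blast
qed

section \<open>Interfaces and the cover relation in coordinates\<close>

text \<open>
  The position of the edge \<open>e_{k,p}\<close>.
\<close>

definition site :: "nat \<Rightarrow> nat \<Rightarrow> int" where "site k p = a k + 2 * (int p - 1)"

lemma site_eq_iff [simp]: "site k p = site k p' \<longleftrightarrow> p = p'"
  by (simp add: site_def)

lemma bonds_eq:
  assumes "k \<le> Suc m"
  shows "bonds k = site k ` {1..Suc (l k)}"
proof (intro equalityI subsetI)
  fix x assume x: "x \<in> bonds k"
  have "even (x - a k)" using x parity[OF assms] by (auto simp: bonds_def)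
  then obtain i where i: "x = a k + 2 * i" by (metis evenE add_diff_cancel_left' diff_add_cancel add.commute)
  then have "0 \<le> i" "i \<le> int (l k)" using x by (auto simp: bonds_def b_def)
  then have "x = site k (Suc (nat i))" "Suc (nat i) \<in> {1..Suc (l k)}" using i by (auto simp: site_def)
  then show "x \<in> site k ` {1..Suc (l k)}" by blast
next
  fix x assume "x \<in> site k ` {1..Suc (l k)}"
  then show "x \<in> bonds k" using parity[OF assms] by (auto simp: bonds_def site_def b_def)
qed

lemma strict_mono_site: "strict_mono_on J (site k)"
  by (auto simp: strict_mono_on_def site_def)

lemma interface_eq: "interface S k = (if 1 \<le> k \<and> k \<le> m then vert k ` bonds k else {})"
proof (cases "1 \<le> k \<and> k \<le> m")
  case False
  then show ?thesis unfolding interface_def by (auto elim!: hexagonE)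
next
  case True
  have "e \<in> interface S k \<longleftrightarrow> (\<exists>c. (int k, c) \<in> S \<and> (e = vert k (c - 1) \<or> e = vert k (c + 1)))" for e
    unfolding interface_def by (force simp: lattice_edge_eqs)
  moreover have "(\<exists>c. (int k, c) \<in> S \<and> (e = vert k (c - 1) \<or> e = vert k (c + 1))) \<longleftrightarrow>
      e \<in> vert k ` bonds k" for e
  proof
    assume "\<exists>c. (int k, c) \<in> S \<and> (e = vert k (c - 1) \<or> e = vert k (c + 1))"
    then obtain c where "(int k, c) \<in> S" "e = vert k (c - 1) \<or> e = vert k (c + 1)" by blast
    moreover then have "c \<noteq> b k" using b_parity[of k] by (auto simp: mem_hexagons)
    ultimately show "e \<in> vert k ` bonds k" by (auto simp: mem_hexagons bonds_def)
  next
    assume "e \<in> vert k ` bonds k"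
    then obtain x where x: "e = vert k x" "x \<in> bonds k" by blast
    show "\<exists>c. (int k, c) \<in> S \<and> (e = vert k (c - 1) \<or> e = vert k (c + 1))"
    proof (cases "x = b k")
      case True
      then show ?thesis using x \<open>1 \<le> k \<and> k \<le> m\<close> a_less_b[of k]
        by (intro exI[of _ "x - 1"]) (auto simp: mem_hexagons bonds_def)
    next
      case False
      then show ?thesis using x \<open>1 \<le> k \<and> k \<le> m\<close>
        by (intro exI[of _ "x + 1"]) (auto simp: mem_hexagons bonds_def)
    qed
  qed
  ultimately show ?thesis using True by auto
qed

lemma inj_vert: "inj_on (vert k) A"
  by (auto intro: inj_onI)

lemma card_interface: "1 \<le> k \<Longrightarrow> k \<le> m \<Longrightarrow> card (interface S k) = Suc (l k)"
  by (simp add: interface_eq card_image inj_vert bonds_eq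
      strict_mono_on_imp_inj_on[OF strict_mono_site])

lemma nth_left_interface:
  assumes "1 \<le> k" "k \<le> m" "p \<in> {1..Suc (l k)}"
  shows "nth_left (interface S k) p = vert k (site k p)"
proof -
  have "count_upto (bonds k) (site k p) = int p"
    unfolding bonds_eq[OF le_SucI[OF assms(2)]] using assms(3)
    by (intro count_upto_image_at strict_mono_site)
  then show ?thesis
    using assms bonds_eq[of k] by (simp add: interface_eq nth_left_vert)
qed

lemma mem_carrier:
  "(k, j) \<in> poset_carrier m n S \<longleftrightarrow> 1 \<le> k \<and> k \<le> m \<and> 1 \<le> j \<and> int j \<le> excess k"
  by (auto simp: poset_carrier_def interface_ord_def card_interface excess_def)

lemma first_bond_eq:
  assumes "1 \<le> k" "Suc k \<le> m"
  shows "first_bond S (Suc k) =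
    (if a k < a (Suc k) then vert k (a k) else vert (Suc k) (a (Suc k)))" (is "_ = ?e")
proof -
  let ?X = "vert k ` bonds k \<union> vert (Suc k) ` bonds (Suc k)"
  have X: "interface_bonds S (Suc k) = ?X"
    using assms by (simp add: interface_bonds_def interface_eq)
  have inj: "inj_on hpos ?X"
    by (rule inj_onI) (auto simp: bonds_def)
  have a: "a i \<in> bonds i" if "i = k \<or> i = Suc k" for i
    using parity[of i] that assms by (auto simp: bonds_def b_def)
  have "\<forall>e\<in>?X. hpos ?e \<le> hpos e"
    by (auto simp: bonds_def)
  moreover have e: "?e \<in> ?X" using a by auto
  ultimately show ?thesis
    unfolding first_bond_def X using inj by (intro nth_left_1) auto
qed

text \<open>
  Placing \<open>s\<close> with coordinates \<open>k, j\<close> at height \<open>a k + 2 j\<close>, the cover relation joins the elements of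
  adjacent rows whose heights differ by one.  Both cases of the definition, an equal index and an
  index raised by one, become this single equation.
\<close>

lemma poset_cover_iff:
  "poset_cover m n S (k, j) (k', j') \<longleftrightarrow>
     (k, j) \<in> poset_carrier m n S \<and> (k', j') \<in> poset_carrier m n S \<and>
     (k' = Suc k \<or> k = Suc k') \<and> a k' + 2 * int j' = a k + 2 * int j + 1"
proof (cases "(k, j) \<in> poset_carrier m n S \<and> (k', j') \<in> poset_carrier m n S \<and>
     (k' = Suc k \<or> k = Suc k')")
  case False
  then show ?thesis unfolding poset_cover_def by auto
next
  case True
  then have rows: "1 \<le> k" "k \<le> m" "1 \<le> k'" "k' \<le> m" by (auto simp: mem_carrier)
  have a: "a i \<in> bonds i" if "i = k \<or> i = k'" for i
    using parity[of i] that rows by (auto simp: bonds_def b_def)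
  have step: "\<bar>a k' - a k\<bar> = 1"
    using True left_step[of k] left_step[of k'] rows by (auto simp: abs_minus_commute)
  have "first_bond S (max k k') = (if a k < a k' then vert k (a k) else vert k' (a k'))"
  proof (cases "k' = Suc k")
    case True
    then show ?thesis using first_bond_eq[of k] rows by simp
  next
    case False
    then have k: "k = Suc k'" using True by simp
    have "a k < a k' \<longleftrightarrow> \<not> a k' < a k" using step by auto
    then show ?thesis using first_bond_eq[of k'] rows by (simp add: k)
  qed
  then have "first_bond S (max k k') \<in> interface S k \<longleftrightarrow> a k < a k'"
    "first_bond S (max k k') \<in> interface S k' \<longleftrightarrow> a k' < a k"
    using a rows True step by (auto simp: interface_eq)
  then show ?thesis
    using True step unfolding poset_cover_def by auto
qed

section \<open>Positions of double interface bonds and proper sextets\<close>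

lemma finite_rungs: "kekule S K \<Longrightarrow> finite (rungs K k)"
  using rungs_subset[OF kekule_subset] finite_subset[OF _ finite_bonds] by blast

lemma
  assumes K: "kekule S K" and k: "1 \<le> k" "k \<le> m" and p: "site k p \<in> rungs K k" "1 \<le> p"
    and j: "count_upto (rungs K k) (site k p) = int j"
  shows tau_eq: "tau m S K (k, j) = vert k (site k p)"
    and pos_eq: "pos m S K (k, j) = p"
proof -
  have "double_interface_bonds m S K \<inter> interface S k = vert k ` rungs K k"
  proof -
    have "vert k ` rungs K k \<subseteq> vert k ` bonds k"
      using rungs_subset[OF kekule_subset[OF K]] by (rule image_mono)
    moreover have "interface S k \<subseteq> (\<Union>k\<in>{1..m}. interface S k)" using k by auto
    moreover have "interface S k = vert k ` bonds k" using k by (simp add: interface_eq)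
    moreover have "K \<inter> vert k ` bonds k \<subseteq> vert k ` rungs K k" "vert k ` rungs K k \<subseteq> K"
      by (auto simp: rungs_def)
    ultimately have "K \<inter> (\<Union>k\<in>{1..m}. interface S k) \<inter> interface S k = vert k ` rungs K k"
      by (metis Int_absorb1 Int_absorb2 Int_assoc Int_commute inf_mono le_inf_iff order_refl
          order_trans subset_antisym)
    then show ?thesis by (simp add: double_interface_bonds_def)
  qed
  then show tau: "tau m S K (k, j) = vert k (site k p)"
    using nth_left_vert[OF finite_rungs[OF K] p(1) j] by simp
  have "site k p \<in> bonds k" using rungs_subset[OF kekule_subset[OF K]] p(1) by blast
  then have "p \<in> {1..Suc (l k)}" using p(2) by (auto simp: bonds_def site_def b_def)
  then show "pos m S K (k, j) = p"
    unfolding pos.simps tau card_interface[OF k]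
    using nth_left_interface[OF k] by (intro the_equality) auto
qed

lemma rungs_eq_pos:
  assumes K: "kekule S K" and k: "1 \<le> k" "k \<le> m"
  shows "rungs K k = {site k (pos m S K (k, j)) | j. (k, j) \<in> poset_carrier m n S}"
proof -
  have at: "\<exists>p. x = site k p \<and> pos m S K (k, j) = p"
    if "x \<in> rungs K k" "count_upto (rungs K k) x = int j" for x j
  proof -
    have "x \<in> bonds k" using rungs_subset[OF kekule_subset[OF K]] that(1) by blast
    then obtain p where "x = site k p" "1 \<le> p" using bonds_eq[of k] k by auto
    then show ?thesis using pos_eq[OF K k] that by blast
  qed
  have card: "int (card (rungs K k)) = excess k" using card_rungs[OF K] k by simp
  show ?thesis
  proof (intro equalityI subsetI)
    fix x assume x: "x \<in> rungs K k"
    let ?j = "card {y \<in> rungs K k. y \<le> x}"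
    have "?j \<le> card (rungs K k)" "0 < ?j"
      using finite_rungs[OF K, of k] x by (auto intro!: card_mono simp: card_gt_0_iff)
    then have "(k, ?j) \<in> poset_carrier m n S" using card k by (simp add: mem_carrier)
    then show "x \<in> {site k (pos m S K (k, j)) | j. (k, j) \<in> poset_carrier m n S}"
      using at[OF x, of ?j] by (auto simp: count_upto_def)
  next
    fix x assume "x \<in> {site k (pos m S K (k, j)) | j. (k, j) \<in> poset_carrier m n S}"
    then obtain j where j: "x = site k (pos m S K (k, j))" "(k, j) \<in> poset_carrier m n S" by blast
    obtain y where "y \<in> rungs K k" "count_upto (rungs K k) y = int j"
      using ex_count_upto[OF finite_rungs[OF K], of "int j" k] card j(2) by (auto simp: mem_carrier)
    then show "x \<in> rungs K k" using at j(1) by metis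
  qed
qed

lemma kekule_vertex:
  assumes "kekule S K" "k \<le> m" "x \<in> {lo k..hi k}"
  shows "of_bool (vert k x \<in> K) + of_bool (vert (Suc k) x \<in> K) +
     of_bool (slant k (x - 1) \<in> K) + of_bool (slant k x \<in> K) = (1::int)"
  using assms unfolding kekule_iff by blast

text \<open>
  The left neighbour \<open>x - 1\<close> of a covered vertex \<open>x\<close> on a zigzag cannot be matched to the right, so it
  is either matched to the left, which is the slanted edge that the sextet needs, or covered by a
  double bond of the adjacent row.
\<close>

lemma in_proper_sextet_iff:
  assumes K: "kekule S K" and k: "1 \<le> k" "k \<le> m" and x: "x \<in> rungs K k"
  shows "in_proper_sextet S K (vert k x) \<longleftrightarrow>
    a k + 2 \<le> x \<and> x - 1 \<notin> rungs K (k - 1) \<and> x - 1 \<notin> rungs K (Suc k)"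
proof -
  note sub = kekule_subset[OF K]
  have xb: "x \<in> bonds k" using rungs_subset[OF sub] x by blast
  have hex: "in_proper_sextet S K (vert k x) \<longleftrightarrow>
      a k + 2 \<le> x \<and> slant (k - 1) (x - 2) \<in> K \<and> slant k (x - 2) \<in> K"
  proof
    assume "in_proper_sextet S K (vert k x)"
    then obtain h where h: "h \<in> S" "right_edge h \<in> K" "upper_left_edge h \<in> K" "lower_left_edge h \<in> K"
      "vert k x \<in> {right_edge h, upper_left_edge h, lower_left_edge h}"
      unfolding in_proper_sextet_def proper_sextet_def by auto
    obtain k' c where k': "h = (int k', c)" "1 \<le> k'" "k' \<le> m" "a k' < c" using hexagonE[OF h(1)] by metis
    have "k' = k" "c = x - 1" using h(5) k'(1,2) by (auto simp: lattice_edge_eqs)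
    then show "a k + 2 \<le> x \<and> slant (k - 1) (x - 2) \<in> K \<and> slant k (x - 2) \<in> K"
      using h k' by (auto simp: lattice_edge_eqs)
  next
    assume *: "a k + 2 \<le> x \<and> slant (k - 1) (x - 2) \<in> K \<and> slant k (x - 2) \<in> K"
    then have "(int k, x - 1) \<in> S" using k xb by (auto simp: mem_hexagons bonds_def)
    then have "proper_sextet S K (int k, x - 1)"
      using * k x by (simp add: proper_sextet_def lattice_edge_eqs rungs_def)
    moreover have "vert k x = right_edge (int k, x - 1)" by (simp add: lattice_edge_eqs)
    ultimately show "in_proper_sextet S K (vert k x)" unfolding in_proper_sextet_def by blast
  qed
  have slant: "slant i (x - 2) \<in> K \<longleftrightarrow> x - 1 \<notin> rungs K k'"
    if "a k + 2 \<le> x" "Suc i = k \<and> k' = i \<or> i = k \<and> k' = Suc k" for i k'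
  proof -
    have i: "i \<le> m" and x1: "x - 1 \<in> {lo i..hi i}" and x0: "x \<in> {lo i..hi i}"
      using that k xb by (auto simp: lo_def hi_def bonds_def)
    have "x - 1 \<notin> rungs K k"
      using rungs_subset[OF sub, of k] xb by (auto simp: bonds_def)
    moreover have "of_bool (vert i x \<in> K) + of_bool (vert (Suc i) x \<in> K) +
      of_bool (slant i (x - 1) \<in> K) + of_bool (slant i x \<in> K) = (1::int)"
      "of_bool (vert i (x - 1) \<in> K) + of_bool (vert (Suc i) (x - 1) \<in> K) +
      of_bool (slant i (x - 2) \<in> K) + of_bool (slant i (x - 1) \<in> K) = (1::int)"
      using kekule_vertex[OF K i x0] kekule_vertex[OF K i x1] by simp_all
    ultimately show ?thesis
      using that(2) x unfolding rungs_def mem_Collect_eq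
      by (elim disjE conjE) (simp_all add: of_bool_def split: if_splits)
  qed
  show ?thesis
    unfolding hex using slant[of "k - 1" "k - 1"] slant[of k "Suc k"] k by auto
qed

end

section \<open>A Kekule structure from an order-preserving labelling\<close>

text \<open>
  A labelling \<open>q\<close> prescribes \<open>pos_K(s) - j\<close> for every \<open>s\<close> with index \<open>j\<close> in its row.  Being weakly
  order-preserving with values in \<open>{0..n}\<close> is exactly what makes the prescribed double bonds fit into
  their rows and interlace.
\<close>

locale strip_labelling = strip_rows +
  fixes q :: "nat \<times> nat \<Rightarrow> nat"
  assumes excess_nonneg: "k \<le> Suc m \<Longrightarrow> 0 \<le> excess k"
    and q_le: "s \<in> poset_carrier m n S \<Longrightarrow> q s \<le> n"
    and q_mono: "poset_cover m n S s t \<Longrightarrow> q s \<le> q t"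
begin

definition quota :: "nat \<Rightarrow> nat" where "quota k = nat (excess k)"

lemma int_quota: "k \<le> Suc m \<Longrightarrow> int (quota k) = excess k"
  by (simp add: quota_def excess_nonneg)

lemma quota_outer: "quota 0 = 0" "quota (Suc m) = 0"
  by (simp_all add: quota_def excess_outer)

lemma mem_carrier_quota: "(k, j) \<in> poset_carrier m n S \<longleftrightarrow> k \<le> Suc m \<and> j \<in> {1..quota k}"
proof (cases "1 \<le> k \<and> k \<le> m")
  case True
  then have "int (quota k) = excess k" by (simp add: int_quota)
  then show ?thesis using True unfolding mem_carrier by auto
next
  case False
  then show ?thesis using quota_outer unfolding mem_carrier by (auto simp: le_Suc_eq not_le)
qed

lemma neighbours:
  assumes "k' = Suc k \<or> k = Suc k'" "k \<le> Suc m" "k' \<le> Suc m"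
  shows "a k' = a k + 1 \<and> quota k' \<le> quota k \<and> quota k \<le> Suc (quota k') \<or>
         a k = a k' + 1 \<and> quota k \<le> quota k' \<and> quota k' \<le> Suc (quota k)"
proof -
  have *: "a (Suc i) = a i + 1 \<and> quota (Suc i) \<le> quota i \<and> quota i \<le> Suc (quota (Suc i)) \<or>
         a i = a (Suc i) + 1 \<and> quota i \<le> quota (Suc i) \<and> quota (Suc i) \<le> Suc (quota i)" if "i \<le> m" for i
    using excess_step[OF that] left_step[OF that] int_quota[of i] int_quota[of "Suc i"] that
    by (auto simp: of_bool_def split: if_splits)
  show ?thesis using *[of k] *[of k'] assms by auto
qed

lemma cover_iff:
  "poset_cover m n S (k, j) (k', j') \<longleftrightarrow> k \<le> Suc m \<and> k' \<le> Suc m \<and> j \<in> {1..quota k} \<and> j' \<in> {1..quota k'} \<and>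
     (k' = Suc k \<or> k = Suc k') \<and> a k' + 2 * int j' = a k + 2 * int j + 1"
  unfolding poset_cover_iff mem_carrier_quota by auto

text \<open>
  Consecutive elements of a row are two cover steps apart, through the row above.  The virtual row
  \<open>0\<close> does not interfere: a row with two elements to connect is not the first one.
\<close>

lemma cover_within_row:
  assumes "k \<le> Suc m" "1 \<le> j" "Suc j \<le> quota k"
  shows "\<exists>u. poset_cover m n S (k, j) u \<and> poset_cover m n S u (k, Suc j)"
proof -
  obtain i where i: "k = Suc i" using assms quota_outer by (cases k) auto
  from neighbours[of i k] i assms(1) consider "a k = a i + 1" "quota k \<le> quota i" | "a i = a k + 1" "quota k \<le> Suc (quota i)"
    by auto
  then show ?thesis
  proof cases
    case 1
    then show ?thesis using assms i by (intro exI[of _ "(i, Suc j)"]) (simp add: cover_iff)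
  next
    case 2
    then show ?thesis using assms i by (intro exI[of _ "(i, j)"]) (simp add: cover_iff)
  qed
qed

lemma q_mono_row:
  assumes "k \<le> Suc m" "1 \<le> i" "i \<le> j" "j \<le> quota k"
  shows "q (k, i) \<le> q (k, j)"
  using assms(3,4)
proof (induction j rule: dec_induct)
  case (step j)
  then obtain u where "poset_cover m n S (k, j) u" "poset_cover m n S u (k, Suc j)"
    using cover_within_row[of k j] assms by auto
  then have "q (k, j) \<le> q (k, Suc j)" using q_mono order_trans by blast
  then show ?case using step by simp
qed simp

definition col :: "nat \<Rightarrow> nat \<Rightarrow> int" where "col k j = site k (q (k, j) + j)"
definition cols :: "nat \<Rightarrow> int set" where "cols k = col k ` {1..quota k}"

lemma col_strict_mono: "k \<le> Suc m \<Longrightarrow> strict_mono_on {1..quota k} (col k)"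
  using q_mono_row by (auto simp: strict_mono_on_def col_def site_def intro!: add_le_less_mono)

lemma cols_subset: "k \<le> Suc m \<Longrightarrow> cols k \<subseteq> bonds k"
proof
  fix x assume k: "k \<le> Suc m" and "x \<in> cols k"
  then obtain j where j: "x = site k (q (k, j) + j)" "j \<in> {1..quota k}" by (auto simp: cols_def col_def)
  then have "q (k, j) \<le> n" using q_le k by (simp add: mem_carrier_quota)
  moreover have "int (quota k) = int (l k) + 1 - int n" using int_quota[OF k] by (simp add: excess_def)
  ultimately have "q (k, j) + j \<in> {1..Suc (l k)}" using j(2) by auto
  then show "x \<in> bonds k" using j(1) bonds_eq[OF k] by auto
qed

lemma finite_cols [simp]: "finite (cols k)"
  by (simp add: cols_def)

lemma card_cols: "k \<le> Suc m \<Longrightarrow> card (cols k) = quota k"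
  unfolding cols_def by (subst card_image[OF strict_mono_on_imp_inj_on[OF col_strict_mono]]) auto

lemma count_cols:
  "k \<le> Suc m \<Longrightarrow> count_upto (cols k) x = int (card {j \<in> {1..quota k}. col k j \<le> x})"
  unfolding cols_def by (rule count_upto_image[OF strict_mono_on_imp_inj_on[OF col_strict_mono]])

lemma col_less_of_cover: "poset_cover m n S (k, j) (k', j') \<Longrightarrow> col k j < col k' j'"
  using q_mono[of "(k, j)" "(k', j')"] by (auto simp: cover_iff col_def site_def)

text \<open>
  The index shifts that define the covers embed the double bonds of one row up to \<open>x\<close> into those of
  the adjacent row, up to one exceptional bond at the left.
\<close>

lemma interlacing:
  assumes "k' = Suc k \<or> k = Suc k'" "k \<le> Suc m" "k' \<le> Suc m" "a k < a k'"
  shows "count_upto (cols k') x \<le> count_upto (cols k) x"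
    and "count_upto (cols k) x \<le> count_upto (cols k') x + 1"
proof -
  let ?J = "{j \<in> {1..quota k}. col k j \<le> x}" and ?J' = "{j \<in> {1..quota k'}. col k' j \<le> x}"
  have nb: "a k' = a k + 1" "quota k' \<le> quota k" "quota k \<le> Suc (quota k')"
    using neighbours[OF assms(1-3)] assms(4) by auto
  have "?J' \<subseteq> ?J"
  proof
    fix j assume j: "j \<in> ?J'"
    then have "col k j < col k' j"
      using nb assms(1-3) by (intro col_less_of_cover) (auto simp: cover_iff)
    then show "j \<in> ?J" using j nb by auto
  qed
  then show "count_upto (cols k') x \<le> count_upto (cols k) x"
    using assms(2,3) by (simp add: count_cols card_mono)
  have "?J \<subseteq> insert 1 (Suc ` ?J')"
  proof
    fix j assume j: "j \<in> ?J"
    show "j \<in> insert 1 (Suc ` ?J')"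
    proof (cases "j = 1")
      case False
      then obtain i where i: "j = Suc i" "1 \<le> i" using j by (cases j) auto
      then have "col k' i < col k j"
        using j nb assms(1-3) by (intro col_less_of_cover) (auto simp: cover_iff)
      then show ?thesis using i j nb by auto
    qed simp
  qed
  then have "card ?J \<le> card (insert 1 (Suc ` ?J'))" by (intro card_mono) auto
  also have "\<dots> \<le> Suc (card (Suc ` ?J'))" by (subst card_insert_if) auto
  also have "card (Suc ` ?J') = card ?J'" by (rule card_image) simp
  finally show "count_upto (cols k) x \<le> count_upto (cols k') x + 1"
    using assms(2,3) by (simp add: count_cols)
qed

text \<open>
  By \<open>path_matching_iff\<close> this quantity must be 0 or 1, and its value, together with the parity
  of the position, dictates whether a slanted edge is chosen.
\<close>

definition level :: "nat \<Rightarrow> int \<Rightarrow> int" where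
  "level k x = count_upto (cols (Suc k)) x - count_upto (cols k) x + of_bool (a k < a (Suc k))"

lemma level_cases: "k \<le> m \<Longrightarrow> level k x = 0 \<or> level k x = 1"
  using interlacing[of "Suc k" k x] interlacing[of k "Suc k" x] neighbours[of "Suc k" k]
  by (auto simp: level_def)

lemma cols_in_zigzag: "k \<le> m \<Longrightarrow> i = k \<or> i = Suc k \<Longrightarrow> cols i \<subseteq> {lo k..hi k}"
  using bonds_in_zigzag[of k] cols_subset[of i] by fastforce

lemma level_lo:
  assumes "k \<le> m"
  shows "level k (lo k - 1) = of_bool (a k < a (Suc k))"
proof -
  have "count_upto (cols i) (lo k - 1) = 0" if "i = k \<or> i = Suc k" for i
    using cols_in_zigzag[OF assms that] by (intro count_upto_below) auto
  then show ?thesis by (simp add: level_def)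
qed

lemma level_hi:
  assumes "k \<le> m"
  shows "level k (hi k) = of_bool (b k < b (Suc k))"
proof -
  have "count_upto (cols i) (hi k) = excess i" if "i = k \<or> i = Suc k" for i
  proof -
    have "count_upto (cols i) (hi k) = int (card (cols i))"
      using cols_in_zigzag[OF assms that] by (intro count_upto_above) auto
    moreover have "i \<le> Suc m" using that assms by auto
    ultimately show ?thesis by (simp add: card_cols int_quota)
  qed
  then show ?thesis using excess_step[OF assms] by (simp add: level_def)
qed

definition matching :: "edge set" where
  "matching = {vert k x | k x. 1 \<le> k \<and> k \<le> m \<and> x \<in> cols k} \<union>
     {slant k x | k x. k \<le> m \<and> lo k \<le> x \<and> x < hi k \<and> level k x = of_bool (even (x + int k))}"

lemma slant_matching: "slant k x \<in> matching \<longleftrightarrow>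
    k \<le> m \<and> lo k \<le> x \<and> x < hi k \<and> level k x = of_bool (even (x + int k))"
  by (auto simp: matching_def)

lemma cols_outer: "cols 0 = {}" "cols (Suc m) = {}"
  by (simp_all add: cols_def quota_outer)

lemma rungs_matching: "k \<le> Suc m \<Longrightarrow> rungs matching k = cols k"
  using cols_outer by (cases "k = 0"; cases "k = Suc m") (auto simp: rungs_def matching_def)

lemma matching_subset: "matching \<subseteq> strip_edges S"
  using cols_subset le_SucI unfolding matching_def strip_edges_eq by blast

lemma kekule_matching: "kekule S matching"
  unfolding kekule_iff_surplus[OF matching_subset]
proof (intro allI impI ballI)
  fix k x assume k: "k \<le> m" and x: "x \<in> {lo k - 1..hi k}"
  have "level k x = (if odd (x + int k) then 1 - of_bool (slant k x \<in> matching)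
      else of_bool (slant k x \<in> matching))"
  proof -
    consider "x = lo k - 1" | "x = hi k" | "lo k \<le> x" "x < hi k" using x by force
    then show ?thesis
    proof cases
      case 1
      moreover have "odd (x + int k) \<longleftrightarrow> a k < a (Suc k)" using lo_parity[OF k] 1 by simp
      ultimately show ?thesis using level_lo[OF k] by (simp add: slant_matching)
    next
      case 2
      then show ?thesis using level_hi[OF k] hi_parity[OF k] by (simp add: slant_matching)
    next
      case 3
      then show ?thesis using level_cases[OF k, of x] k by (auto simp: slant_matching)
    qed
  qed
  then show "count_upto (rungs matching (Suc k)) x - count_upto (rungs matching k) x =
      (if odd (x + int k) then 1 - of_bool (slant k x \<in> matching) else of_bool (slant k x \<in> matching)) -
      of_bool (a k < a (Suc k))"
    using k by (simp only: rungs_matching le_SucI Suc_le_mono) (simp add: level_def)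
qed

lemma
  assumes "(k, j) \<in> poset_carrier m n S"
  shows tau_matching: "tau m S matching (k, j) = vert k (col k j)"
    and pos_matching: "pos m S matching (k, j) = q (k, j) + j"
proof -
  have k: "1 \<le> k" "k \<le> m" "k \<le> Suc m" and j: "j \<in> {1..quota k}"
    using iffD1[OF mem_carrier assms] iffD1[OF mem_carrier_quota assms] by auto
  have "col k j \<in> rungs matching k"
    using rungs_matching[OF k(3)] j by (simp add: cols_def)
  moreover have "count_upto (rungs matching k) (col k j) = int j"
    unfolding rungs_matching[OF k(3)] cols_def
    by (rule count_upto_image_at[OF col_strict_mono[OF k(3)] j])
  moreover have "1 \<le> q (k, j) + j" using j by simp
  ultimately have prems: "site k (q (k, j) + j) \<in> rungs matching k" "1 \<le> q (k, j) + j"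
    "count_upto (rungs matching k) (site k (q (k, j) + j)) = int j"
    by (simp_all only: col_def)
  show "tau m S matching (k, j) = vert k (col k j)"
    unfolding col_def by (rule tau_eq[OF kekule_matching k(1,2) prems])
  show "pos m S matching (k, j) = q (k, j) + j"
    by (rule pos_eq[OF kekule_matching k(1,2) prems])
qed

text \<open>
  The row of the higher element contains, at most as far to the right as this element, an element
  that covers the lower one.
\<close>

lemma q_le_of_left:
  assumes "(k, j) \<in> poset_carrier m n S" "(k', j') \<in> poset_carrier m n S" "k' = Suc k \<or> k = Suc k'"
    and "a k + 2 * int j < a k' + 2 * int j'"
  shows "q (k, j) \<le> q (k', j')"
proof -
  from neighbours[of k' k] assms consider "a k' = a k + 1" | "a k = a k' + 1"
    by (auto simp: mem_carrier_quota)
  then obtain i where i: "a k' + 2 * int i = a k + 2 * int j + 1" "j \<le> i"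
  proof cases
    case 1
    then show ?thesis using that[of j] by simp
  next
    case 2
    then show ?thesis using that[of "Suc j"] by simp
  qed
  then have "i \<le> j'" using assms(4) by linarith
  then have "poset_cover m n S (k, j) (k', i)"
    using i assms(1-3) by (auto simp: cover_iff mem_carrier_quota)
  moreover have "q (k', i) \<le> q (k', j')"
    using i \<open>i \<le> j'\<close> assms(1,2) by (intro q_mono_row) (auto simp: mem_carrier_quota)
  ultimately show ?thesis using q_mono order_trans by blast
qed

text \<open>
  A double bond immediately to the left of that of \<open>s\<close> in an adjacent row can only belong to a lower
  cover of \<open>s\<close>: at any other height, \<open>q_le_of_left\<close> orders the labels of the two elements so that
  their double bonds are further apart or in the opposite order.
\<close>

lemma left_neighbour_iff:
  assumes "(k, j) \<in> poset_carrier m n S" "k' = Suc k \<or> k = Suc k'"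
  shows "col k j - 1 \<in> cols k' \<longleftrightarrow> (\<exists>j'. poset_cover m n S (k', j') (k, j) \<and> q (k', j') = q (k, j))"
proof
  assume "col k j - 1 \<in> cols k'"
  then obtain j' where j': "j' \<in> {1..quota k'}" "col k' j' = col k j - 1" by (auto simp: cols_def)
  have c: "(k', j') \<in> poset_carrier m n S"
  proof -
    have "k' \<le> Suc m" using iffD1[OF mem_carrier assms(1)] assms(2) by auto
    then show ?thesis using j'(1) by (simp add: mem_carrier_quota)
  qed
  have eq: "a k' + 2 * int j' + 2 * int (q (k', j')) + 1 = a k + 2 * int j + 2 * int (q (k, j))"
    using j'(2) by (simp add: col_def site_def algebra_simps)
  have "q (k', j') \<le> q (k, j)" if "a k' + 2 * int j' < a k + 2 * int j"
    using q_le_of_left[OF c assms(1)] assms(2) that by auto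
  moreover have "q (k, j) \<le> q (k', j')" if "a k + 2 * int j < a k' + 2 * int j'"
    using q_le_of_left[OF assms(1) c] assms(2) that by auto
  ultimately have "q (k', j') = q (k, j)" "a k + 2 * int j = a k' + 2 * int j' + 1"
    using eq by presburger+
  then show "\<exists>j'. poset_cover m n S (k', j') (k, j) \<and> q (k', j') = q (k, j)"
    using c assms by (auto simp: poset_cover_iff)
next
  assume "\<exists>j'. poset_cover m n S (k', j') (k, j) \<and> q (k', j') = q (k, j)"
  then obtain j' where "poset_cover m n S (k', j') (k, j)" "q (k', j') = q (k, j)" by blast
  then have "j' \<in> {1..quota k'}" "col k' j' = col k j - 1" by (auto simp: cover_iff col_def site_def)
  then show "col k j - 1 \<in> cols k'" unfolding cols_def by (metis imageI)
qed

text \<open>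
  A double bond lies in a proper sextet iff it could be shifted to the left by one hexagon: it is
  not at the left boundary and no lower cover blocks it.  An element with index \<open>j \<ge> 2\<close> and label 0
  has room to its left but is blocked, since it has a lower cover, whose label is 0 as well; this is
  why \<open>0 < q s\<close> describes the boundary condition.
\<close>

lemma sextet_subposet_matching:
  "sextet_subposet m n S matching =
     {s \<in> poset_carrier m n S. 0 < q s \<and> (\<forall>t. poset_cover m n S t s \<longrightarrow> q t < q s)}"
proof -
  have "in_proper_sextet S matching (tau m S matching (k, j)) \<longleftrightarrow>
      0 < q (k, j) \<and> (\<forall>t. poset_cover m n S t (k, j) \<longrightarrow> q t < q (k, j))"
    if c: "(k, j) \<in> poset_carrier m n S" for k j
  proof -
    have k: "1 \<le> k" "k \<le> m" "k \<le> Suc m" and j: "1 \<le> j" "j \<le> quota k"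
      using iffD1[OF mem_carrier c] iffD1[OF mem_carrier_quota c] by auto
    have "col k j \<in> rungs matching k" using rungs_matching[OF k(3)] j by (simp add: cols_def)
    then have "in_proper_sextet S matching (tau m S matching (k, j)) \<longleftrightarrow>
        a k + 2 \<le> col k j \<and> col k j - 1 \<notin> cols (k - 1) \<and> col k j - 1 \<notin> cols (Suc k)"
      using in_proper_sextet_iff[OF kekule_matching k(1,2)] rungs_matching[of "k - 1"]
        rungs_matching[of "Suc k"] k by (simp add: tau_matching[OF c] del: tau.simps)
    also have "\<dots> \<longleftrightarrow> 2 \<le> q (k, j) + j \<and> (\<forall>t. poset_cover m n S t (k, j) \<longrightarrow> q t \<noteq> q (k, j))"
    proof -
      have "a k + 2 \<le> col k j \<longleftrightarrow> 2 \<le> q (k, j) + j" by (auto simp: col_def site_def)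
      moreover have "col k j - 1 \<in> cols (k - 1) \<or> col k j - 1 \<in> cols (Suc k) \<longleftrightarrow>
          (\<exists>k' j'. poset_cover m n S (k', j') (k, j) \<and> q (k', j') = q (k, j))" (is "?L \<longleftrightarrow> ?R")
      proof
        assume ?L
        then show ?R
          using left_neighbour_iff[OF c, of "k - 1"] left_neighbour_iff[OF c, of "Suc k"] k(1)
          by fastforce
      next
        assume ?R
        then obtain k' j' where t: "poset_cover m n S (k', j') (k, j)" "q (k', j') = q (k, j)" by blast
        then have "k' = k - 1 \<or> k' = Suc k" by (auto simp: cover_iff)
        moreover have "col k j - 1 \<in> cols k'"
          using left_neighbour_iff[OF c, of k'] t by (auto simp: cover_iff)
        ultimately show ?L by blast
      qed
      ultimately show ?thesis unfolding split_paired_All by blast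
    qed
    also have "\<dots> \<longleftrightarrow> 0 < q (k, j) \<and> (\<forall>t. poset_cover m n S t (k, j) \<longrightarrow> q t < q (k, j))"
    proof (cases "q (k, j) = 0 \<and> 2 \<le> j")
      case True
      then have "1 \<le> j - 1" "Suc (j - 1) = j" by auto
      then obtain u where u: "poset_cover m n S u (k, j)"
        using cover_within_row[of k "j - 1"] k j by metis
      then have "q u = q (k, j)" using q_mono[OF u] True by simp
      then show ?thesis using u by (metis less_irrefl)
    next
      case False
      then have "2 \<le> q (k, j) + j \<longleftrightarrow> 0 < q (k, j)" using j by auto
      moreover have "q t < q (k, j) \<longleftrightarrow> q t \<noteq> q (k, j)" if "poset_cover m n S t (k, j)" for t
        using q_mono[OF that] by auto
      ultimately show ?thesis by blast
    qed
    finally show ?thesis .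
  qed
  then show ?thesis unfolding sextet_subposet_def by (auto simp del: tau.simps)
qed

end

section \<open>Regular strips as families of rows\<close>

text \<open>
  The virtual rows are inserted half a unit inside the first and the last row, which is why their
  left ends are \<open>c 1\<close> and \<open>c m\<close>, the centres of the leftmost hexagons there.
\<close>

lemma regular_strip_rows:
  assumes "regular_strip m n S"
  obtains a l where "strip_rows m n S a l"
proof -
  obtain c :: "nat \<Rightarrow> int" and len :: "nat \<Rightarrow> nat" where m: "m \<ge> 1"
    and row: "\<forall>k\<in>{1..m}. len k \<ge> 1 \<and> (int k, c k) \<in> lattice_hexagons"
    and S: "S = (\<Union>k\<in>{1..m}. one_tier (int k) (c k) (len k))"
    and step: "\<forall>k\<in>{1..<m}. \<bar>c (k + 1) - c k\<bar> = 1 \<and>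
           \<bar>right_end (c (k + 1)) (len (k + 1)) - right_end (c k) (len k)\<bar> = 1"
    and len: "len 1 = n" "len m = n"
    using assms unfolding regular_strip_def by blast
  define a where "a k = (if k = 0 then c 1 else if k \<le> m then c k - 1 else c m)" for k
  define l where "l k = (if k = 0 \<or> m < k then n - 1 else len k)" for k
  have n: "1 \<le> n" using row len m by auto
  have inner: "a k = c k - 1" "l k = len k" "1 \<le> len k" "odd (c k + int k)" if "1 \<le> k" "k \<le> m" for k
    using that row by (auto simp: a_def l_def lattice_hexagons_def add.commute)
  have outer: "a 0 = c 1" "a (Suc m) = c m" "l 0 = n - 1" "l (Suc m) = n - 1"
    by (simp_all add: a_def l_def)
  have steps: "\<bar>a (Suc k) - a k\<bar> = 1 \<and> \<bar>(a (Suc k) + 2 * int (l (Suc k))) - (a k + 2 * int (l k))\<bar> = 1"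
    if km: "k \<le> m" for k
  proof -
    consider "k = 0" | "k = m" | "1 \<le> k" "k < m" using km by linarith
    then show ?thesis
    proof cases
      case 1
      then show ?thesis using outer inner[of 1] m len n by (simp add: of_nat_diff)
    next
      case 2
      then show ?thesis using outer inner[of m] m len n by (simp add: of_nat_diff)
    next
      case 3
      then have "\<bar>c (k + 1) - c k\<bar> = 1"
        "\<bar>right_end (c (k + 1)) (len (k + 1)) - right_end (c k) (len k)\<bar> = 1"
        using step by auto
      then show ?thesis using 3 inner[of k] inner[of "Suc k"] by (simp add: right_end_def)
    qed
  qed
  have par: "even (a k + int k)" if km: "k \<le> Suc m" for k
  proof -
    consider "k = 0" | "k = Suc m" | "1 \<le> k" "k \<le> m" using km by linarith
    then show ?thesis
    proof cases
      case 1
      then show ?thesis using outer inner(4)[of 1] m by simp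
    next
      case 2
      then show ?thesis using outer inner(4)[of m] m by simp
    next
      case 3
      then show ?thesis using inner[of k] by simp
    qed
  qed
  have row_eq: "one_tier (int k) (c k) (len k) =
      {(int k, x + 1) | x. a k \<le> x \<and> x < a k + 2 * int (l k) \<and> even (x + int k)}" (is "_ = ?R")
    if k: "1 \<le> k" "k \<le> m" for k
  proof (intro equalityI subsetI)
    fix h assume "h \<in> one_tier (int k) (c k) (len k)"
    then obtain i where "h = (int k, (c k + 2 * int i - 1) + 1)" "i < len k" by (auto simp: one_tier_def)
    moreover have "a k \<le> c k + 2 * int i - 1" "even (c k + 2 * int i - 1 + int k)"
      using inner[OF k] by auto
    moreover have "c k + 2 * int i - 1 < a k + 2 * int (l k)" using inner[OF k] \<open>i < len k\<close> by auto
    ultimately show "h \<in> ?R" by blast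
  next
    fix h assume "h \<in> ?R"
    then obtain x where x: "h = (int k, x + 1)" "a k \<le> x" "x < a k + 2 * int (l k)" "even (x + int k)" by blast
    have "even (x - a k)" using x(4) par[of k] k by auto
    then obtain i where "x - a k = 2 * i" by (rule evenE)
    then have "h = (int k, c k + 2 * int (nat i))" "nat i < len k" using x inner[OF k] by auto
    then show "h \<in> one_tier (int k) (c k) (len k)" unfolding one_tier_def by blast
  qed
  have "strip_rows m n S a l"
  proof
    show "S = {(int k, x + 1) | k x. 1 \<le> k \<and> k \<le> m \<and>
      a k \<le> x \<and> x < a k + 2 * int (l k) \<and> even (x + int k)}"
    proof -
      have "S = (\<Union>k\<in>{1..m}. {(int k, x + 1) | x. a k \<le> x \<and> x < a k + 2 * int (l k) \<and> even (x + int k)})"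
        unfolding S using row_eq by (intro SUP_cong) auto
      then show ?thesis by auto
    qed
  qed (use par steps inner outer m n len in auto)
  then show ?thesis using that by blast
qed

section \<open>From strictly order-preserving maps to Kekule structures\<close>

lemma tranclp_lower_cover:
  assumes "r\<^sup>+\<^sup>+ s u"
  shows "\<exists>t. (s = t \<or> r\<^sup>+\<^sup>+ s t) \<and> r t u"
  using assms by (cases rule: tranclp.cases) auto

theorem lemma23:
  fixes m n :: nat and S :: "hexagon set" and A :: "(nat \<times> nat) set" and \<mu> :: "nat \<times> nat \<Rightarrow> nat"
  assumes "regular_strip m n S"
    and "\<exists>K. kekule S K"
    and "A \<subseteq> poset_carrier m n S"
    and "\<mu> ` A \<subseteq> {1..n}"
    and "monotone_on A (poset_less m n S) (<) \<mu>"
  shows "\<exists>!K. kekule S K \<and>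
    (\<forall>(k, j)\<in>A. pos m S K (k, j) = \<mu> (k, j) + j) \<and>
    (\<forall>(k, j)\<in>poset_carrier m n S - A.
       pos m S K (k, j) = Max ({\<mu> s' | s'. s' \<in> A \<and> poset_less m n S s' (k, j)} \<union> {0}) + j) \<and>
    sextet_subposet m n S K = A"
proof -
  obtain a l where "strip_rows m n S a l" using regular_strip_rows[OF assms(1)] .
  then interpret strip_rows m n S a l .
  let ?P = "poset_carrier m n S" and ?lt = "poset_less m n S"
  \<comment> \<open>The labelling forced by the two conditions on positions.\<close>
  define below where "below s = {\<mu> s' | s'. s' \<in> A \<and> ?lt s' s} \<union> {0}" for s
  define q where "q s = (if s \<in> A then \<mu> s else Max (below s))" for s
  have fin: "finite (below s)" for s
  proof -
    have "below s \<subseteq> insert 0 (\<mu> ` A)" by (auto simp: below_def)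
    moreover have "finite (\<mu> ` A)" using assms(4) finite_subset by blast
    ultimately show ?thesis using finite_subset by blast
  qed
  have \<mu>: "1 \<le> \<mu> s" "\<mu> s \<le> n" if "s \<in> A" for s using assms(4) that by auto
  have \<mu>_less: "\<mu> s < \<mu> t" if "s \<in> A" "t \<in> A" "?lt s t" for s t
    using assms(5) that by (simp add: monotone_on_def)
  have trans: "?lt s u" if "?lt s t" "?lt t u" for s t u
    using that unfolding poset_less_def by (rule tranclp_trans)
  have q_below: "x \<le> q s" if x: "x \<in> below s" for x s
  proof (cases "s \<in> A")
    case True
    then show ?thesis using x by (auto simp: below_def q_def dest: \<mu>_less intro: less_imp_le)
  next
    case False
    then show ?thesis using x fin by (simp add: q_def)
  qed
  have q_in: "q s \<in> below s" if "s \<notin> A" for s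
    using Max_in[OF fin, of s] that by (auto simp: q_def below_def)
  have q_mono_less: "q s \<le> q t" if "?lt s t" for s t
  proof -
    have "q s \<in> below t"
    proof (cases "s \<in> A")
      case True
      then have "q s = \<mu> s" by (simp add: q_def)
      then show ?thesis using True that unfolding below_def by blast
    next
      case False
      then show ?thesis using q_in[OF False] trans[OF _ that] unfolding below_def by blast
    qed
    then show ?thesis by (rule q_below)
  qed
  have q_mono: "q s \<le> q t" if "poset_cover m n S s t" for s t
    using that q_mono_less by (simp add: poset_less_def tranclp.r_into_trancl)
  have q_le: "q s \<le> n" for s
    using q_in[of s] \<mu>(2) by (cases "s \<in> A") (auto simp: below_def q_def)
  \<comment> \<open>A label outside \<open>A\<close> is 0 or repeats one of a smaller element, hence that of a lower cover.\<close>
  have A_eq: "{s \<in> ?P. 0 < q s \<and> (\<forall>t. poset_cover m n S t s \<longrightarrow> q t < q s)} = A"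
  proof (intro equalityI subsetI)
    fix s assume s: "s \<in> A"
    have "q t < q s" if "poset_cover m n S t s" for t
    proof -
      have lt: "?lt t s" using that by (simp add: poset_less_def tranclp.r_into_trancl)
      show ?thesis
      proof (cases "t \<in> A")
        case True
        then show ?thesis using \<mu>_less s lt by (simp add: q_def)
      next
        case False
        then show ?thesis
          using q_in[OF False] \<mu>_less[OF _ s] \<mu>(1)[OF s] trans[OF _ lt] s
          by (auto simp: below_def q_def[of s])
      qed
    qed
    then show "s \<in> {s \<in> ?P. 0 < q s \<and> (\<forall>t. poset_cover m n S t s \<longrightarrow> q t < q s)}"
      using s assms(3) \<mu>(1)[OF s] by (auto simp: q_def)
  next
    fix s assume s: "s \<in> {s \<in> ?P. 0 < q s \<and> (\<forall>t. poset_cover m n S t s \<longrightarrow> q t < q s)}"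
    show "s \<in> A"
    proof (rule ccontr)
      assume "s \<notin> A"
      then obtain s' where s': "s' \<in> A" "?lt s' s" "q s = q s'"
        using q_in[of s] s by (auto simp: below_def q_def)
      then obtain t where t: "s' = t \<or> ?lt s' t" "poset_cover m n S t s"
        using tranclp_lower_cover[of "poset_cover m n S" s' s] unfolding poset_less_def by blast
      then have "q s' \<le> q t" using q_mono_less by (metis order_refl)
      moreover have "q t < q s" using s t(2) by blast
      ultimately show False using s'(3) by simp
    qed
  qed
  \<comment> \<open>Counting the double bonds of the given Kekule structure shows that no \<open>ord\<close> is negative.\<close>
  obtain K0 where "kekule S K0" using assms(2) by blast
  then have "0 \<le> excess k" if "k \<le> Suc m" for k
    using card_rungs[OF _ that] by (metis of_nat_0_le_iff)
  then interpret strip_labelling m n S a l q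
    by unfold_locales (use q_le q_mono in auto)
  have cond: "(\<forall>(k, j)\<in>A. pos m S K (k, j) = \<mu> (k, j) + j) \<and>
      (\<forall>(k, j)\<in>?P - A. pos m S K (k, j) = Max ({\<mu> s' | s'. s' \<in> A \<and> ?lt s' (k, j)} \<union> {0}) + j)
      \<longleftrightarrow> (\<forall>(k, j)\<in>?P. pos m S K (k, j) = q (k, j) + j)" for K
    using assms(3) unfolding q_def below_def by (auto simp del: pos.simps)
  show ?thesis
  proof (rule ex1I[of _ matching])
    show "kekule S matching \<and>
      (\<forall>(k, j)\<in>A. pos m S matching (k, j) = \<mu> (k, j) + j) \<and>
      (\<forall>(k, j)\<in>?P - A.
         pos m S matching (k, j) = Max ({\<mu> s' | s'. s' \<in> A \<and> ?lt s' (k, j)} \<union> {0}) + j) \<and>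
      sextet_subposet m n S matching = A"
      using kekule_matching cond[of matching] pos_matching sextet_subposet_matching A_eq
      by (simp del: pos.simps) blast
  next
    fix K assume K: "kekule S K \<and>
      (\<forall>(k, j)\<in>A. pos m S K (k, j) = \<mu> (k, j) + j) \<and>
      (\<forall>(k, j)\<in>?P - A.
         pos m S K (k, j) = Max ({\<mu> s' | s'. s' \<in> A \<and> ?lt s' (k, j)} \<union> {0}) + j) \<and>
      sextet_subposet m n S K = A"
    then have pos: "pos m S K (k, j) = q (k, j) + j" if "(k, j) \<in> ?P" for k j
      using cond[of K] that by blast
    show "K = matching"
    proof (rule kekule_eqI)
      show "kekule S K" using K by blast
      fix k assume k: "1 \<le> k" "k \<le> m"
      show "rungs K k = rungs matching k"
        unfolding rungs_eq_pos[OF \<open>kekule S K\<close> k] rungs_eq_pos[OF kekule_matching k]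
        using pos pos_matching by (metis (no_types, lifting))
    qed (rule kekule_matching)
  qed
qed

end
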